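(* There exists a unique collection $\{\mathbb{D}_n\}_{n\ge0}$ of linear endomorphisms $\mathbb{D}_n$ of $C(\mathcal{G}_n^F)$ such that: (i) $\mathbb{D}_0=\mathrm{id}_{\mathbb{C}}$, and for all positive integers $n_1,n_2$ and all $f_i\in C(\mathcal{G}_{n_i}^F)$, $\mathbb{D}_{n_1+n_2}\big(R^{n_1+n_2}_{n_1,n_2}(f_1\boxtimes f_2)\big)=R^{n_1+n_2}_{n_1,n_2}\big(\mathbb{D}_{n_1}(f_1)\boxtimes\mathbb{D}_{n_2}(f_2)\big)$; (ii) for all $n\ge1$, $\mathbb{D}_n(f)=(-1)^{n-1}f$ for every pre-cuspidal $f\in C(\mathcal{G}_n^F)$.
   Context: Let $q$ be a prime power, $\mathcal{G}_n^F=\mathfrak{gl}_n(\mathbb{F}_q)$, $G_n^F=\mathrm{GL}_n(\mathbb{F}_q)$, and $C(\mathcal{G}_n^F)$ the complex functions on $\mathfrak{gl}_n(\mathbb{F}_q)$ invariant under $G_n^F$-conjugation ($C(\mathcal{G}_0^F)=\mathbb{C}$). View $\mathfrak{gl}_{n_1}\times\mathfrak{gl}_{n_2}$ as the block-diagonal matrices $\mathcal{L}_{n_1,n_2}$ in $\mathfrak{gl}_{n_1+n_2}$, $P$ the corresponding block upper triangular parabolic with Lie algebra $\mathcal{P}$, projection $\pi:\mathcal{P}\to\mathcal{L}_{n_1,n_2}$; Harish-Chandra induction is $R^{n}_{n_1,n_2}(\phi)(x)=\frac{1}{|P^F|}\sum_{g\in G_n^F,\,gxg^{-1}\in\mathcal{P}^F}\phi(\pi(gxg^{-1}))$,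 where $n=n_1+n_2$ and $f_1\boxtimes f_2$ is the external product. For a standard parabolic $P=L\ltimes U_P$, Harish-Chandra restriction is ${}^*R^{\mathcal{G}_n}_{\mathcal{L}}(f)(x)=\frac{1}{|U_P^F|}\sum_{y\in\mathcal{U}_P^F}f(x+y)$. A function $f\in C(\mathcal{G}_n^F)$ is pre-cuspidal if ${}^*R^{\mathcal{G}_n}_{\mathcal{L}}(f)=0$ for every Lie algebra $\mathcal{L}$ of an $F$-stable Levi subgroup of an $F$-stable proper parabolic subgroup of $\mathrm{GL}_n$. *)

theory Defs
  imports "Jordan_Normal_Form.Gauss_Jordan_Elimination" Complex_Main
begin

text \<open>The finite field F_q is modelled by a type 'a of class {finite, field}
 (its cardinality q is automatically a prime power). Matrices are JNF matrices;
 gl_n(F_q) is carrier_mat n n, GL_n(F_q) the invertible ones.  Complex functions on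
 gl_n(F_q) are functions 'a mat => complex which vanish outside carrier_mat n n.\<close>

definition GLn :: "nat \<Rightarrow> ('a::{finite,field}) mat set" where
  "GLn n = {g \<in> carrier_mat n n. invertible_mat g}"

definition minv :: "('a::{finite,field}) mat \<Rightarrow> 'a mat" where
  "minv g = the (mat_inverse g)"

definition conjm :: "('a::{finite,field}) mat \<Rightarrow> 'a mat \<Rightarrow> 'a mat" where
  "conjm g x = g * x * minv g"

definition classfun :: "nat \<Rightarrow> (('a::{finite,field}) mat \<Rightarrow> complex) set" where
  "classfun n = {f. (\<forall>x. x \<notin> carrier_mat n n \<longrightarrow> f x = 0) \<and>
      (\<forall>g \<in> GLn n. \<forall>x \<in> carrier_mat n n. f (conjm g x) = f x)}"

text \<open>Composition ns = [n_1,...,n_k] of n; block index of a row/column index i.\<close>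
definition blk :: "nat list \<Rightarrow> nat \<Rightarrow> nat" where
  "blk ns i = card {k. k < length ns \<and> sum_list (take (Suc k) ns) \<le> i}"

definition levi_alg :: "nat list \<Rightarrow> ('a::{finite,field}) mat set" where
  "levi_alg ns = {x \<in> carrier_mat (sum_list ns) (sum_list ns).
      \<forall>i < sum_list ns. \<forall>j < sum_list ns. blk ns i \<noteq> blk ns j \<longrightarrow> x $$ (i,j) = 0}"

definition parab_alg :: "nat list \<Rightarrow> ('a::{finite,field}) mat set" where
  "parab_alg ns = {x \<in> carrier_mat (sum_list ns) (sum_list ns).
      \<forall>i < sum_list ns. \<forall>j < sum_list ns. blk ns i > blk ns j \<longrightarrow> x $$ (i,j) = 0}"

definition unip_alg :: "nat list \<Rightarrow> ('a::{finite,field}) mat set" where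
  "unip_alg ns = {x \<in> carrier_mat (sum_list ns) (sum_list ns).
      \<forall>i < sum_list ns. \<forall>j < sum_list ns. blk ns i \<ge> blk ns j \<longrightarrow> x $$ (i,j) = 0}"

definition parab_grp :: "nat list \<Rightarrow> ('a::{finite,field}) mat set" where
  "parab_grp ns = GLn (sum_list ns) \<inter> parab_alg ns"

definition levi_proj :: "nat list \<Rightarrow> ('a::{finite,field}) mat \<Rightarrow> 'a mat" where
  "levi_proj ns x = mat (dim_row x) (dim_col x)
      (\<lambda>(i,j). if blk ns i = blk ns j then x $$ (i,j) else 0)"

definition ext_prod :: "nat \<Rightarrow> nat \<Rightarrow> (('a::{finite,field}) mat \<Rightarrow> complex) \<Rightarrow> ('a mat \<Rightarrow> complex)
    \<Rightarrow> 'a mat \<Rightarrow> complex" where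
  "ext_prod n1 n2 f1 f2 x =
     f1 (mat n1 n1 (\<lambda>(i,j). x $$ (i,j))) * f2 (mat n2 n2 (\<lambda>(i,j). x $$ (i + n1, j + n1)))"

definition HC_ind :: "nat \<Rightarrow> nat \<Rightarrow> (('a::{finite,field}) mat \<Rightarrow> complex) \<Rightarrow> 'a mat \<Rightarrow> complex" where
  "HC_ind n1 n2 \<phi> x =
     (if x \<in> carrier_mat (n1+n2) (n1+n2) then
        (1 / of_nat (card (parab_grp [n1,n2] :: 'a mat set))) *
        (\<Sum>g \<in> {g \<in> GLn (n1+n2). conjm g x \<in> parab_alg [n1,n2]}.
            \<phi> (levi_proj [n1,n2] (conjm g x)))
      else 0)"

text \<open>Harish-Chandra restriction to the Levi g L g^{-1} of the F-stable parabolic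
 g P g^{-1}, where P is the standard parabolic attached to ns and g \<in> GL_n(F_q);
 these are all pairs (F-stable parabolic, F-stable Levi) of GL_n.\<close>
definition HC_res :: "nat list \<Rightarrow> ('a::{finite,field}) mat \<Rightarrow> ('a mat \<Rightarrow> complex) \<Rightarrow> 'a mat \<Rightarrow> complex" where
  "HC_res ns g f x =
     (1 / of_nat (card (conjm g ` unip_alg ns :: 'a mat set))) *
     (\<Sum>y \<in> conjm g ` unip_alg ns. f (x + y))"

definition pre_cuspidal :: "nat \<Rightarrow> (('a::{finite,field}) mat \<Rightarrow> complex) \<Rightarrow> bool" where
  "pre_cuspidal n f \<longleftrightarrow>
     (\<forall>ns. \<forall>g \<in> (GLn n :: 'a mat set). sum_list ns = n \<and> length ns \<ge> 2 \<and> (\<forall>m \<in> set ns. m > 0) \<longrightarrow>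
        (\<forall>x \<in> conjm g ` levi_alg ns. HC_res ns g f x = 0))"

definition lin_endo :: "nat \<Rightarrow> ((('a::{finite,field}) mat \<Rightarrow> complex) \<Rightarrow> ('a mat \<Rightarrow> complex)) \<Rightarrow> bool" where
  "lin_endo n T \<longleftrightarrow>
     (\<forall>f \<in> classfun n. T f \<in> classfun n) \<and>
     (\<forall>f \<in> classfun n. \<forall>h \<in> classfun n. T (\<lambda>x. f x + h x) = (\<lambda>x. T f x + T h x)) \<and>
     (\<forall>c. \<forall>f \<in> classfun n. T (\<lambda>x. c * f x) = (\<lambda>x. c * T f x))"

definition duality_family :: "(nat \<Rightarrow> (('a::{finite,field}) mat \<Rightarrow> complex) \<Rightarrow> ('a mat \<Rightarrow> complex)) \<Rightarrow> bool" where
  "duality_family D \<longleftrightarrow>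
     (\<forall>n. lin_endo n (D n)) \<and>
     (\<forall>f \<in> classfun 0. D 0 f = f) \<and>
     (\<forall>n1 n2 f1 f2. n1 > 0 \<longrightarrow> n2 > 0 \<longrightarrow> f1 \<in> classfun n1 \<longrightarrow> f2 \<in> classfun n2 \<longrightarrow>
        D (n1+n2) (HC_ind n1 n2 (ext_prod n1 n2 f1 f2)) = HC_ind n1 n2 (ext_prod n1 n2 (D n1 f1) (D n2 f2))) \<and>
     (\<forall>n \<ge> 1. \<forall>f \<in> classfun n. pre_cuspidal n f \<longrightarrow> D n f = (\<lambda>x. (-1) ^ (n - 1) * f x))"

end

theory Submission
  imports Defs "Jordan_Normal_Form.Determinant"
begin

text \<open>
  Grade the class functions by the number of cuspidal factors. Let \<open>Fil_k\<close> be the space of class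
  functions whose sums over the cosets \<open>x + U_P\<close> vanish for all parabolics \<open>P\<close> with more than \<open>k\<close>
  blocks and all \<open>x\<close> in the Lie algebra of \<open>P\<close>. Its orthogonal complement \<open>E_(k+1)\<close> is spanned by
  the class averages of the indicator functions of those cosets, so the spaces
  \<open>A_k = Fil_k \<inter> E_k\<close> are an orthogonal decomposition.

  Induction respects both filtrations: \<open>E_k * E_l \<subseteq> E_(k+l)\<close> because inducing a product of coset
  averages gives a multiple of a coset average, and \<open>Fil_k * Fil_l \<subseteq> Fil_(k+l)\<close> because by the Bruhat
  decomposition a flag with more than \<open>k+l\<close> steps meets a subspace and its quotient in coordinate
  position, and cuts one of them into more than \<open>k\<close> or more than \<open>l\<close> pieces. Hence
  \<open>A_k * A_l \<subseteq> A_(k+l)\<close>, and \<open>D = (-1)^(n-k)\<close> on \<open>A_k\<close> is multiplicative. For \<open>n \<ge> 1\<close> the pre-cuspidal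
  functions are exactly \<open>A_1 = Fil_1\<close>.
  Uniqueness is an induction on \<open>n\<close>: a class function orthogonal to everything induced from proper
  Levi subalgebras is pre-cuspidal.
\<close>

subsection \<open>General linear groups over a finite field\<close>

text \<open>Duality is classically an alternating sum of restrictions followed by inductions, and
  its compatibility with induction then rests on a Mackey formula. Here the operator is prescribed
  by its eigenvalues instead. The sign is forced: a cuspidal factor of size n_i contributes
  (-1)^(n_i - 1), so k factors of total size n give (-1)^(n-k). What needs proof is that the number
  of factors is a well-defined degree, additive under induction. Bounding the degree from below is
  nearly built into the generators. Bounding it from above is the hard half, since induction
  conjugates the test parabolic into arbitrary relative position; only after reduction to
  permutations do both parabolics contain the diagonal torus. The two bounds are linked by a
  reciprocity: a coset sum of a class function is, up to |GL_n|, its inner product with the class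
  average of the coset. The bottom degree depends on n: for n >= 1 the cosets of the one-block
  parabolic are points, so E_1 is everything; for n = 0 there is no block at all, so E_0 is
  everything and the sign is +1.\<close>

lemma finite_carrier_mat [simp]: "finite (carrier_mat n m :: 'a::finite mat set)"
proof -
  have "carrier_mat n m \<subseteq> (\<lambda>f. mat n m f) ` (({..<n} \<times> {..<m}) \<rightarrow>\<^sub>E (UNIV :: 'a set))"
  proof
    fix x :: "'a mat" assume x: "x \<in> carrier_mat n m"
    let ?f = "restrict (\<lambda>ij. x $$ ij) ({..<n} \<times> {..<m})"
    have "x = mat n m ?f" using x by (intro eq_matI) auto
    moreover have "?f \<in> ({..<n} \<times> {..<m}) \<rightarrow>\<^sub>E (UNIV :: 'a set)" by simp
    ultimately show "x \<in> (\<lambda>f. mat n m f) ` (({..<n} \<times> {..<m}) \<rightarrow>\<^sub>E UNIV)" by blast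
  qed
  then show ?thesis
    by (rule finite_subset) (intro finite_imageI finite_PiE; simp)
qed

lemma GLn_iff:
  "g \<in> GLn n \<longleftrightarrow> g \<in> carrier_mat n n \<and> (\<exists>h \<in> carrier_mat n n. g * h = 1\<^sub>m n \<and> h * g = 1\<^sub>m n)"
proof
  assume g: "g \<in> GLn n"
  then have gc: "g \<in> carrier_mat n n" by (simp add: GLn_def)
  from g obtain h where h: "g * h = 1\<^sub>m (dim_row g)" "h * g = 1\<^sub>m (dim_row h)"
    unfolding GLn_def invertible_mat_def inverts_mat_def by blast
  have d: "dim_row g = n" "dim_col g = n" using gc by auto
  have "dim_col h = dim_col (g * h)" by simp
  also have "\<dots> = n" unfolding h(1) d by simp
  finally have c: "dim_col h = n" .
  have "dim_row h = dim_col (h * g)" unfolding h(2) by simp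
  then have r: "dim_row h = n" by (simp add: d)
  show "g \<in> carrier_mat n n \<and> (\<exists>h \<in> carrier_mat n n. g * h = 1\<^sub>m n \<and> h * g = 1\<^sub>m n)"
    using gc h c r d by (intro conjI bexI[of _ h] carrier_matI) simp_all
next
  assume "g \<in> carrier_mat n n \<and> (\<exists>h \<in> carrier_mat n n. g * h = 1\<^sub>m n \<and> h * g = 1\<^sub>m n)"
  then obtain h where g: "g \<in> carrier_mat n n" and h: "h \<in> carrier_mat n n" "g * h = 1\<^sub>m n" "h * g = 1\<^sub>m n"
    by blast
  then have "inverts_mat g h" "inverts_mat h g" by (simp_all add: inverts_mat_def)
  then show "g \<in> GLn n"
    using g unfolding GLn_def invertible_mat_def by auto
qed

lemma GLn_I:
  assumes "g \<in> carrier_mat n n" "h \<in> carrier_mat n n" "g * h = 1\<^sub>m n"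
  shows "g \<in> GLn n"
  using assms mat_mult_left_right_inverse[OF assms] by (auto simp: GLn_iff)

lemma GLn_carrier [simp]: "g \<in> GLn n \<Longrightarrow> g \<in> carrier_mat n n"
  by (simp add: GLn_def)

lemma finite_GLn [simp]: "finite (GLn n)"
  by (rule finite_subset[of _ "carrier_mat n n"]) auto

lemma minv_props:
  assumes "g \<in> GLn n"
  shows "minv g \<in> carrier_mat n n" "g * minv g = 1\<^sub>m n" "minv g * g = 1\<^sub>m n"
proof -
  have gc: "g \<in> carrier_mat n n" using assms by simp
  have U: "g \<in> Units (ring_mat TYPE('a) n ())"
    using assms unfolding GLn_iff Units_def by (simp add: ring_mat_simps) blast
  obtain h where "mat_inverse g = Some h"
  proof (cases "mat_inverse g")
    case None
    from mat_inverse(1)[OF gc this, of "()"] U show ?thesis by blast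
  qed
  with mat_inverse(2)[OF gc this]
  show "minv g \<in> carrier_mat n n" "g * minv g = 1\<^sub>m n" "minv g * g = 1\<^sub>m n"
    by (simp_all add: minv_def)
qed

lemma minv_unique:
  assumes "g \<in> GLn n" "h \<in> carrier_mat n n" "g * h = 1\<^sub>m n"
  shows "minv g = h"
proof -
  have "minv g = minv g * (g * h)" using assms minv_props[OF assms(1)] by simp
  also have "\<dots> = minv g * g * h"
    by (rule assoc_mult_mat[symmetric, of _ n n _ n _ n]) (use assms minv_props[OF assms(1)] in auto)
  also have "\<dots> = h" using assms minv_props[OF assms(1)] by simp
  finally show ?thesis .
qed

lemma minv_GLn: "g \<in> GLn n \<Longrightarrow> minv g \<in> GLn n"
  using minv_props[of g n] by (intro GLn_I[of _ _ g]) auto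

lemma one_GLn [simp]: "1\<^sub>m n \<in> GLn n"
  by (rule GLn_I[of _ _ "1\<^sub>m n"]) auto

lemma minv_one [simp]: "minv (1\<^sub>m n) = (1\<^sub>m n :: 'a::{finite,field} mat)"
  by (rule minv_unique[of _ n]) auto

lemma mult_cancel4:
  assumes "a \<in> carrier_mat n n" "b \<in> carrier_mat n n" "c \<in> carrier_mat n n" "d \<in> carrier_mat n n"
  shows "a * b * (c * d) = a * (b * c) * d"
  using assms by (simp add: assoc_mult_mat[of _ n n _ n _ n])

lemma
  assumes "g \<in> GLn n" "h \<in> GLn n" shows mult_GLn: "g * h \<in> GLn n"
    and minv_mult: "minv (g * h) = minv h * minv g"
proof -
  note p = minv_props[OF assms(1)] minv_props[OF assms(2)] GLn_carrier[OF assms(1)] GLn_carrier[OF assms(2)]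
  have "g * h * (minv h * minv g) = 1\<^sub>m n"
    using p by (subst mult_cancel4[where n = n]) auto
  moreover have c: "g * h \<in> carrier_mat n n" "minv h * minv g \<in> carrier_mat n n" using p by auto
  ultimately show "g * h \<in> GLn n" by (intro GLn_I)
  then show "minv (g * h) = minv h * minv g" using c \<open>g * h * _ = _\<close> by (intro minv_unique)
qed

lemma conjm_carrier [simp]:
  "g \<in> GLn n \<Longrightarrow> x \<in> carrier_mat n n \<Longrightarrow> conjm g x \<in> carrier_mat n n"
  using minv_props[of g n] by (auto simp: conjm_def dest!: GLn_carrier)

text \<open>An intertwining equation identifies a conjugate without computing an inverse; used for
  permutation matrices.\<close>

lemma conjm_eqI:
  assumes "g \<in> GLn n" "x \<in> carrier_mat n n" "y \<in> carrier_mat n n" "g * x = y * g"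
  shows "conjm g x = y"
  using assms minv_props[OF assms(1)] by (simp add: conjm_def assoc_mult_mat[of y n n g n _ n])

lemma conjm_mult:
  assumes "g \<in> GLn n" "h \<in> GLn n" "x \<in> carrier_mat n n"
  shows "conjm (g * h) x = conjm g (conjm h x)"
proof -
  note p = minv_props[OF assms(1)] minv_props[OF assms(2)] GLn_carrier[OF assms(1)] GLn_carrier[OF assms(2)] assms(3)
  show ?thesis
    unfolding conjm_def minv_mult[OF assms(1,2)] using p
    by (simp add: assoc_mult_mat[of _ n n _ n _ n])
qed

lemma conjm_one [simp]: "x \<in> carrier_mat n n \<Longrightarrow> conjm (1\<^sub>m n) x = x"
  by (simp add: conjm_def)

lemma conjm_minv:
  assumes "g \<in> GLn n" "x \<in> carrier_mat n n"
  shows "conjm (minv g) (conjm g x) = x" "conjm g (conjm (minv g) x) = x"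
  using conjm_mult[OF minv_GLn[OF assms(1)] assms(1,2), symmetric] conjm_mult[OF assms(1) minv_GLn[OF assms(1)] assms(2), symmetric]
    minv_props(2,3)[OF assms(1)] assms by simp_all

lemma conjm_add:
  assumes "g \<in> GLn n" "x \<in> carrier_mat n n" "y \<in> carrier_mat n n"
  shows "conjm g (x + y) = conjm g x + conjm g y"
  using assms minv_props[OF assms(1)] GLn_carrier[OF assms(1)]
  by (simp add: conjm_def mult_add_distrib_mat[of _ n n _ n] add_mult_distrib_mat[of _ n n _ _ n] mult_carrier_mat[of _ n n _ n])

lemma bij_conjm: "g \<in> GLn n \<Longrightarrow> bij_betw (conjm g) (carrier_mat n n) (carrier_mat n n)"
  by (rule bij_betw_byWitness[of _ "conjm (minv g)"]) (auto simp: conjm_minv minv_GLn)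

lemma bij_GLn_mult_right:
  assumes "h \<in> GLn n" shows "bij_betw (\<lambda>g. g * h) (GLn n) (GLn n)"
proof (rule bij_betw_byWitness[of _ "\<lambda>g. g * minv h"])
  note p = minv_props[OF assms] GLn_carrier[OF assms]
  show "\<forall>a\<in>GLn n. a * h * minv h = a" "\<forall>a\<in>GLn n. a * minv h * h = a"
    using p by (auto simp: assoc_mult_mat[of _ n n _ n _ n] dest: GLn_carrier)
qed (use assms in \<open>auto intro!: mult_GLn minv_GLn\<close>)

lemma bij_GLn_mult_left:
  assumes "h \<in> GLn n" shows "bij_betw (\<lambda>g. h * g) (GLn n) (GLn n)"
proof (rule bij_betw_byWitness[of _ "\<lambda>g. minv h * g"])
  note p = minv_props[OF assms] GLn_carrier[OF assms]
  show "\<forall>a\<in>GLn n. minv h * (h * a) = a" "\<forall>a\<in>GLn n. h * (minv h * a) = a"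
    using p by (auto simp: assoc_mult_mat[of _ n n _ n _ n, symmetric] simp del: assoc_mult_mat dest: GLn_carrier)
qed (use assms in \<open>auto intro!: mult_GLn minv_GLn\<close>)

text \<open>Finiteness replaces any computation with inverses: left multiplication by
  \<open>b\<close> is an injective self-map of the finite set \<open>S\<close>, hence surjective,
  and so it hits the identity.\<close>

lemma minv_in_submonoid:
  assumes S: "S \<subseteq> carrier_mat n n" "1\<^sub>m n \<in> S" "\<And>a b. a \<in> S \<Longrightarrow> b \<in> S \<Longrightarrow> a * b \<in> S"
    and b: "b \<in> S" "b \<in> GLn n"
  shows "minv b \<in> S"
proof -
  have "inj_on (\<lambda>c. b * c) S"
  proof (rule inj_on_inverseI[of _ "\<lambda>c. minv b * c"])
    fix c assume "c \<in> S"
    then show "minv b * (b * c) = c"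
      using S minv_props[OF b(2)] b(2) by (subst assoc_mult_mat[of _ n n _ n _ n, symmetric]) auto
  qed
  moreover have "finite S" using S(1) finite_subset finite_carrier_mat by blast
  moreover have "(\<lambda>c. b * c) ` S \<subseteq> S" using S(3) b(1) by auto
  ultimately have "(\<lambda>c. b * c) ` S = S" by (meson endo_inj_surj)
  then obtain c where "c \<in> S" "1\<^sub>m n = b * c" using S(2) by auto
  then show ?thesis using minv_unique[OF b(2), of c] S(1) by auto
qed

subsection \<open>Coloured parabolics\<close>

text \<open>
  A parabolic containing the diagonal torus is given by a colouring \<open>\<beta>\<close> of the indices, its blocks being
  the colour classes in increasing order. Colour classes need not be intervals: permuting the
  coordinates then only replaces \<open>\<beta>\<close> by \<open>\<beta> \<circ> \<sigma>\<close>. The colours of indices \<open>\<ge> n\<close> are irrelevant.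
\<close>

definition color_parab :: "nat \<Rightarrow> (nat \<Rightarrow> nat) \<Rightarrow> 'a::{finite,field} mat set" where
  "color_parab n \<beta> = {x \<in> carrier_mat n n. \<forall>i<n. \<forall>j<n. \<beta> j < \<beta> i \<longrightarrow> x $$ (i,j) = 0}"

definition color_nil :: "nat \<Rightarrow> (nat \<Rightarrow> nat) \<Rightarrow> 'a::{finite,field} mat set" where
  "color_nil n \<beta> = {x \<in> carrier_mat n n. \<forall>i<n. \<forall>j<n. \<beta> j \<le> \<beta> i \<longrightarrow> x $$ (i,j) = 0}"

text \<open>\<open>N\<close> is the set of free positions. It is kept general because coset sums are
  later refined to sums over smaller sets of free positions that are not unipotent radicals.\<close>

definition entry_coset :: "nat \<Rightarrow> (nat \<times> nat) set \<Rightarrow> 'a::{finite,field} mat \<Rightarrow> 'a mat set" where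
  "entry_coset n N x = {y \<in> carrier_mat n n. \<forall>i<n. \<forall>j<n. (i,j) \<notin> N \<longrightarrow> y $$ (i,j) = x $$ (i,j)}"

abbreviation color_coset :: "nat \<Rightarrow> (nat \<Rightarrow> nat) \<Rightarrow> 'a::{finite,field} mat \<Rightarrow> 'a mat set" where
  "color_coset n \<beta> x \<equiv> entry_coset n {(i,j). \<beta> i < \<beta> j} x"

lemma color_parab_carrier: "x \<in> color_parab n \<beta> \<Longrightarrow> x \<in> carrier_mat n n"
  by (simp add: color_parab_def)

lemma finite_entry_coset [simp]: "finite (entry_coset n N x)"
  by (rule finite_subset[of _ "carrier_mat n n"]) (auto simp: entry_coset_def)

lemma entry_coset_carrier: "y \<in> entry_coset n N x \<Longrightarrow> y \<in> carrier_mat n n"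
  by (simp add: entry_coset_def)

lemma index_mult_carrier:
  assumes "a \<in> carrier_mat n n" "b \<in> carrier_mat n n" "i < n" "j < n"
  shows "(a * b) $$ (i,j) = (\<Sum>k<n. a $$ (i,k) * b $$ (k,j))"
  using assms by (simp add: scalar_prod_def atLeast0LessThan)

lemma color_parab_mult:
  assumes "a \<in> color_parab n \<beta>" "b \<in> color_parab n \<beta>"
  shows "a * b \<in> color_parab n \<beta>"
proof -
  have c: "a \<in> carrier_mat n n" "b \<in> carrier_mat n n" using assms by (auto simp: color_parab_def)
  have "(a * b) $$ (i,j) = 0" if "i < n" "j < n" "\<beta> j < \<beta> i" for i j
    unfolding index_mult_carrier[OF c that(1,2)]
  proof (intro sum.neutral ballI)
    fix k assume "k \<in> {..<n}"
    then show "a $$ (i,k) * b $$ (k,j) = 0"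
      using assms that unfolding color_parab_def by (cases "\<beta> k < \<beta> i") auto
  qed
  then show ?thesis using c by (auto simp: color_parab_def)
qed

text \<open>With the right-hand version this makes the nilradical an ideal of the parabolic algebra,
  which is why conjugation by the parabolic group permutes its cosets.\<close>

lemma color_nil_mult_left:
  assumes "a \<in> color_parab n \<beta>" "b \<in> color_nil n \<beta>"
  shows "a * b \<in> color_nil n \<beta>"
proof -
  have c: "a \<in> carrier_mat n n" "b \<in> carrier_mat n n" using assms by (auto simp: color_nil_def color_parab_def)
  have "(a * b) $$ (i,j) = 0" if "i < n" "j < n" "\<beta> j \<le> \<beta> i" for i j
    unfolding index_mult_carrier[OF c that(1,2)]
  proof (intro sum.neutral ballI)
    fix k assume "k \<in> {..<n}"
    then show "a $$ (i,k) * b $$ (k,j) = 0"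
      using assms that unfolding color_parab_def color_nil_def by (cases "\<beta> k < \<beta> i") auto
  qed
  then show ?thesis using c by (auto simp: color_nil_def)
qed

lemma color_nil_mult_right:
  assumes "b \<in> color_parab n \<beta>" "a \<in> color_nil n \<beta>"
  shows "a * b \<in> color_nil n \<beta>"
proof -
  have c: "a \<in> carrier_mat n n" "b \<in> carrier_mat n n" using assms by (auto simp: color_nil_def color_parab_def)
  have "(a * b) $$ (i,j) = 0" if "i < n" "j < n" "\<beta> j \<le> \<beta> i" for i j
    unfolding index_mult_carrier[OF c that(1,2)]
  proof (intro sum.neutral ballI)
    fix k assume "k \<in> {..<n}"
    then show "a $$ (i,k) * b $$ (k,j) = 0"
      using assms that unfolding color_parab_def color_nil_def by (cases "\<beta> k \<le> \<beta> i") auto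
  qed
  then show ?thesis using c by (auto simp: color_nil_def)
qed

lemma one_color_parab [simp]: "1\<^sub>m n \<in> color_parab n \<beta>"
  by (auto simp: color_parab_def)

lemma minv_color_parab: "b \<in> color_parab n \<beta> \<Longrightarrow> b \<in> GLn n \<Longrightarrow> minv b \<in> color_parab n \<beta>"
  by (rule minv_in_submonoid[of "color_parab n \<beta>" n]) (auto intro: color_parab_mult color_parab_carrier)

lemma conjm_color_parab:
  "b \<in> color_parab n \<beta> \<Longrightarrow> b \<in> GLn n \<Longrightarrow> x \<in> color_parab n \<beta> \<Longrightarrow> conjm b x \<in> color_parab n \<beta>"
  unfolding conjm_def by (intro color_parab_mult minv_color_parab)

lemma color_coset_iff:
  assumes "x \<in> carrier_mat n n"
  shows "y \<in> color_coset n \<beta> x \<longleftrightarrow> (\<exists>u \<in> color_nil n \<beta>. y = x + u)"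
proof
  assume y: "y \<in> color_coset n \<beta> x"
  have "y = x + (y - x)" using y assms by (intro eq_matI) (auto simp: entry_coset_def)
  moreover have "y - x \<in> color_nil n \<beta>"
    using y assms by (auto simp: entry_coset_def color_nil_def)
  ultimately show "\<exists>u \<in> color_nil n \<beta>. y = x + u" by blast
next
  assume "\<exists>u \<in> color_nil n \<beta>. y = x + u"
  then show "y \<in> color_coset n \<beta> x"
    using assms by (auto simp: entry_coset_def color_nil_def)
qed

lemma conjm_color_coset_mem:
  assumes "b \<in> color_parab n \<beta>" "b \<in> GLn n" "x \<in> carrier_mat n n" "y \<in> color_coset n \<beta> x"
  shows "conjm b y \<in> color_coset n \<beta> (conjm b x)"
proof -
  from assms obtain u where u: "u \<in> color_nil n \<beta>" "y = x + u" by (auto simp: color_coset_iff)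
  have "conjm b u \<in> color_nil n \<beta>"
    using assms u unfolding conjm_def by (intro color_nil_mult_left color_nil_mult_right minv_color_parab)
  moreover have "u \<in> carrier_mat n n" using u by (simp add: color_nil_def)
  ultimately show ?thesis using u assms by (auto simp: color_coset_iff conjm_add)
qed

lemma bij_conjm_color_coset:
  assumes "b \<in> color_parab n \<beta>" "b \<in> GLn n" "x \<in> carrier_mat n n"
  shows "bij_betw (conjm b) (color_coset n \<beta> x) (color_coset n \<beta> (conjm b x))"
proof (rule bij_betw_byWitness[of _ "conjm (minv b)"])
  show "\<forall>y\<in>color_coset n \<beta> x. conjm (minv b) (conjm b y) = y"
    "\<forall>y\<in>color_coset n \<beta> (conjm b x). conjm b (conjm (minv b) y) = y"
    using assms(2) by (blast intro: conjm_minv entry_coset_carrier)+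
  show "conjm b ` color_coset n \<beta> x \<subseteq> color_coset n \<beta> (conjm b x)"
    using conjm_color_coset_mem[OF assms] by blast
  show "conjm (minv b) ` color_coset n \<beta> (conjm b x) \<subseteq> color_coset n \<beta> x"
    using conjm_color_coset_mem[OF minv_color_parab[OF assms(1,2)] minv_GLn[OF assms(2)] conjm_carrier[OF assms(2,3)]]
    unfolding conjm_minv(1)[OF assms(2,3)] by blast
qed

text \<open>A coset with free positions \<open>N\<close> is a disjoint union of cosets with fewer
  free positions \<open>N'\<close>, so vanishing on the pieces suffices. This is how a sum is
  localised to a single diagonal block, or to a smaller unipotent radical.\<close>

lemma sum_entry_coset_eq_0:
  assumes "N' \<subseteq> N"
    and z: "\<And>y. y \<in> entry_coset n N x \<Longrightarrow> (\<Sum>y' \<in> entry_coset n N' y. F y') = (0 :: complex)"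
  shows "(\<Sum>y \<in> entry_coset n N x. F y) = 0"
proof -
  let ?C = "entry_coset n N x"
  \<comment> \<open>Erasing the entries in \<open>N'\<close> labels the pieces: the fibres of
    \<open>r\<close> on \<open>?C\<close> are exactly the finer cosets.\<close>
  define r where "r = (\<lambda>y. mat n n (\<lambda>ij. if ij \<in> N' then 0 else y $$ ij) :: 'a mat)"
  have "(\<Sum>y \<in> {y \<in> ?C. r y = t}. F y) = 0" if t: "t \<in> r ` ?C" for t
  proof -
    from t obtain y0 where y0: "y0 \<in> ?C" "t = r y0" by auto
    have "{y \<in> ?C. r y = t} = entry_coset n N' y0"
    proof (intro equalityI subsetI)
      fix y assume y: "y \<in> {y \<in> ?C. r y = t}"
      have "y $$ (i,j) = y0 $$ (i,j)" if "i < n" "j < n" "(i,j) \<notin> N'" for i j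
      proof -
        have "r y $$ (i,j) = r y0 $$ (i,j)" using y y0 by simp
        with that show ?thesis by (simp add: r_def)
      qed
      then show "y \<in> entry_coset n N' y0" using y by (auto simp: entry_coset_def)
    next
      fix y assume y: "y \<in> entry_coset n N' y0"
      have "y $$ (i,j) = x $$ (i,j)" if "i < n" "j < n" "(i,j) \<notin> N" for i j
      proof -
        have "(i,j) \<notin> N'" using assms(1) that by blast
        then show ?thesis using y y0(1) that unfolding entry_coset_def by simp
      qed
      then have "y \<in> ?C" using entry_coset_carrier[OF y] unfolding entry_coset_def by blast
      moreover have "r y = r y0" unfolding r_def
        using y y0 by (intro eq_matI) (auto simp: entry_coset_def)
      ultimately show "y \<in> {y \<in> ?C. r y = t}" using y0 by simp
    qed
    then show ?thesis using z[OF y0(1)] by simp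
  qed
  then have "0 = (\<Sum>t \<in> r ` ?C. \<Sum>y \<in> {y \<in> ?C. r y = t}. F y)" by simp
  also have "(\<Sum>t \<in> r ` ?C. \<Sum>y \<in> {y \<in> ?C. r y = t}. F y) = (\<Sum>y \<in> ?C. F y)"
    by (rule sum.group) auto
  finally show ?thesis by simp
qed

section \<open>Permutation matrices acting on coloured parabolics and their cosets\<close>

definition perm_mat :: "nat \<Rightarrow> (nat \<Rightarrow> nat) \<Rightarrow> 'a::{finite,field} mat" where
  "perm_mat n \<sigma> = mat n n (\<lambda>(i,j). if j = \<sigma> i then 1 else 0)"

definition permute_mat :: "nat \<Rightarrow> (nat \<Rightarrow> nat) \<Rightarrow> 'a::{finite,field} mat \<Rightarrow> 'a mat" where
  "permute_mat n \<sigma> x = mat n n (\<lambda>(i,j). x $$ (\<sigma> i, \<sigma> j))"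

lemma perm_mat_carrier [simp]: "perm_mat n \<sigma> \<in> carrier_mat n n"
  by (simp add: perm_mat_def)

lemma permute_mat_carrier [simp]: "permute_mat n \<sigma> x \<in> carrier_mat n n"
  by (simp add: permute_mat_def)

lemma permute_mat_index [simp]:
  "i < n \<Longrightarrow> j < n \<Longrightarrow> permute_mat n \<sigma> x $$ (i,j) = x $$ (\<sigma> i, \<sigma> j)"
  by (simp add: permute_mat_def)

lemma perm_mat_mult:
  assumes "\<sigma> i < n" "x \<in> carrier_mat n n" "i < n" "j < n"
  shows "(perm_mat n \<sigma> * x) $$ (i,j) = x $$ (\<sigma> i, j)"
proof -
  have "(perm_mat n \<sigma> * x) $$ (i,j) = (\<Sum>k<n. (if k = \<sigma> i then x $$ (k,j) else 0))"
    unfolding index_mult_carrier[OF perm_mat_carrier assms(2-4)]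
    by (intro sum.cong) (use assms in \<open>auto simp: perm_mat_def\<close>)
  then show ?thesis using assms(1) by simp
qed

lemma perm_mat_GLn:
  assumes "bij_betw \<sigma> {..<n} {..<n}"
  shows "(perm_mat n \<sigma> :: 'a::{finite,field} mat) \<in> GLn n"
proof -
  let ?h = "mat n n (\<lambda>(i,j). if i = \<sigma> j then 1 else 0) :: 'a mat"
  have "perm_mat n \<sigma> * ?h = 1\<^sub>m n"
  proof (rule eq_matI)
    fix i j assume ij: "i < dim_row (1\<^sub>m n :: 'a mat)" "j < dim_col (1\<^sub>m n :: 'a mat)"
    then have "\<sigma> i < n" using assms by (auto dest: bij_betwE)
    moreover have "\<sigma> i = \<sigma> j \<longleftrightarrow> i = j" using assms ij by (auto simp: bij_betw_def inj_on_def)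
    ultimately show "(perm_mat n \<sigma> * ?h) $$ (i,j) = 1\<^sub>m n $$ (i,j)"
      using ij by (subst perm_mat_mult) auto
  qed (simp_all add: perm_mat_def)
  then show ?thesis by (rule GLn_I[rotated 2]) auto
qed

lemma conjm_perm_mat:
  assumes "bij_betw \<sigma> {..<n} {..<n}" "x \<in> carrier_mat n n"
  shows "conjm (perm_mat n \<sigma>) x = permute_mat n \<sigma> x"
proof (rule conjm_eqI[OF perm_mat_GLn[OF assms(1)] assms(2) permute_mat_carrier])
  show "perm_mat n \<sigma> * x = permute_mat n \<sigma> x * perm_mat n \<sigma>"
  proof (rule eq_matI)
    fix i j assume "i < dim_row (permute_mat n \<sigma> x * perm_mat n \<sigma>)" "j < dim_col (permute_mat n \<sigma> x * perm_mat n \<sigma>)"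
    then have ij: "i < n" "j < n" by (simp_all add: permute_mat_def perm_mat_def)
    have \<sigma>: "\<sigma> k < n" if "k < n" for k using assms(1) that by (auto dest: bij_betwE)
    from ij assms(1) have "j \<in> \<sigma> ` {..<n}" by (simp add: bij_betw_def)
    then obtain l where l: "l < n" "\<sigma> l = j" by auto
    have eq: "j = \<sigma> k \<longleftrightarrow> k = l" if "k < n" for k
      using assms(1) l that by (auto simp: bij_betw_def inj_on_def)
    have "(permute_mat n \<sigma> x * perm_mat n \<sigma>) $$ (i,j) = (\<Sum>k<n. (if k = l then x $$ (\<sigma> i, \<sigma> k) else 0))"
      unfolding index_mult_carrier[OF permute_mat_carrier perm_mat_carrier ij]
      by (intro sum.cong) (use ij eq in \<open>auto simp: perm_mat_def\<close>)
    also have "\<dots> = x $$ (\<sigma> i, j)" using l by simp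
    finally show "(perm_mat n \<sigma> * x) $$ (i,j) = (permute_mat n \<sigma> x * perm_mat n \<sigma>) $$ (i,j)"
      using ij \<sigma> assms(2) by (simp add: perm_mat_mult del: index_mult_mat)
  qed (use assms(2) in \<open>auto simp: perm_mat_def permute_mat_def\<close>)
qed

lemma permute_color_coset:
  assumes \<sigma>: "\<And>i. i < n \<Longrightarrow> \<sigma> i < n" and "y \<in> color_coset n \<beta> x"
  shows "permute_mat n \<sigma> y \<in> color_coset n (\<beta> \<circ> \<sigma>) (permute_mat n \<sigma> x)"
  using assms by (auto simp: entry_coset_def)

lemma permute_color_parab:
  assumes \<sigma>: "\<And>i. i < n \<Longrightarrow> \<sigma> i < n" and "x \<in> color_parab n \<beta>"
  shows "permute_mat n \<sigma> x \<in> color_parab n (\<beta> \<circ> \<sigma>)"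
  using assms by (auto simp: color_parab_def)

lemma permute_mat_permute_mat:
  assumes "\<And>i. i < n \<Longrightarrow> \<tau> i < n" "\<And>i. i < n \<Longrightarrow> \<sigma> (\<tau> i) = i" "y \<in> carrier_mat n n"
  shows "permute_mat n \<tau> (permute_mat n \<sigma> y) = y"
  using assms by (intro eq_matI) (auto simp: permute_mat_def)

lemma sum_permute_color_coset:
  assumes "bij_betw \<sigma> {..<n} {..<n}"
  shows "(\<Sum>y \<in> color_coset n \<beta> x. F (permute_mat n \<sigma> y)) =
    (\<Sum>y \<in> color_coset n (\<beta> \<circ> \<sigma>) (permute_mat n \<sigma> x). F y)"
proof (rule sum.reindex_bij_betw)
  define \<tau> where "\<tau> = inv_into {..<n} \<sigma>"
  have s: "\<And>i. i < n \<Longrightarrow> \<sigma> i < n" using assms by (auto dest: bij_betwE)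
  have t: "\<And>i. i < n \<Longrightarrow> \<tau> i < n" "\<And>i. i < n \<Longrightarrow> \<sigma> (\<tau> i) = i" "\<And>i. i < n \<Longrightarrow> \<tau> (\<sigma> i) = i"
    using bij_betwE[OF bij_betw_inv_into[OF assms]] bij_betw_inv_into_right[OF assms]
      bij_betw_inv_into_left[OF assms] by (auto simp: \<tau>_def)
  show "bij_betw (permute_mat n \<sigma>) (color_coset n \<beta> x) (color_coset n (\<beta> \<circ> \<sigma>) (permute_mat n \<sigma> x))"
  proof (rule bij_betw_byWitness[of _ "permute_mat n \<tau>"])
    show "\<forall>y\<in>color_coset n \<beta> x. permute_mat n \<tau> (permute_mat n \<sigma> y) = y"
      using t by (auto intro!: permute_mat_permute_mat entry_coset_carrier)
    show "\<forall>y\<in>color_coset n (\<beta> \<circ> \<sigma>) (permute_mat n \<sigma> x). permute_mat n \<sigma> (permute_mat n \<tau> y) = y"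
      using t s by (auto intro!: permute_mat_permute_mat entry_coset_carrier)
    show "permute_mat n \<sigma> ` color_coset n \<beta> x \<subseteq> color_coset n (\<beta> \<circ> \<sigma>) (permute_mat n \<sigma> x)"
      using permute_color_coset[of n \<sigma>, OF s] by blast
    show "permute_mat n \<tau> ` color_coset n (\<beta> \<circ> \<sigma>) (permute_mat n \<sigma> x) \<subseteq> color_coset n \<beta> x"
    proof
      fix z assume "z \<in> permute_mat n \<tau> ` color_coset n (\<beta> \<circ> \<sigma>) (permute_mat n \<sigma> x)"
      then obtain y where y: "y \<in> color_coset n (\<beta> \<circ> \<sigma>) (permute_mat n \<sigma> x)" "z = permute_mat n \<tau> y"
        by blast
      have "z $$ (i,j) = x $$ (i,j)" if "i < n" "j < n" "\<not> \<beta> i < \<beta> j" for i j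
      proof -
        have "y $$ (\<tau> i, \<tau> j) = permute_mat n \<sigma> x $$ (\<tau> i, \<tau> j)"
          using y(1) t(1)[OF that(1)] t(1)[OF that(2)] that(3) t(2)[OF that(1)] t(2)[OF that(2)]
          unfolding entry_coset_def by simp
        then show ?thesis using y(2) that t by simp
      qed
      then show "z \<in> color_coset n \<beta> x" using y(2) by (simp add: entry_coset_def)
    qed
  qed
qed

subsection \<open>Bruhat decomposition\<close>

text \<open>These are the pivot matrices of Gaussian elimination. Left multiplication by
  \<open>col_subst\<close> rescales row \<open>i\<close> and adds multiples of it to all other rows
  at once; right multiplication by \<open>row_subst\<close> does the same for columns. One factor
  thus clears a whole column or row.\<close>

definition col_subst :: "nat \<Rightarrow> nat \<Rightarrow> (nat \<Rightarrow> 'a) \<Rightarrow> 'a::{finite,field} mat" where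
  "col_subst n i v = mat n n (\<lambda>(r,c). if c = i then v r else if r = c then 1 else 0)"

definition row_subst :: "nat \<Rightarrow> nat \<Rightarrow> (nat \<Rightarrow> 'a) \<Rightarrow> 'a::{finite,field} mat" where
  "row_subst n i v = mat n n (\<lambda>(r,c). if r = i then v c else if r = c then 1 else 0)"

lemma subst_carrier [simp]: "col_subst n i v \<in> carrier_mat n n" "row_subst n i v \<in> carrier_mat n n"
  by (simp_all add: col_subst_def row_subst_def)

lemma col_subst_mult:
  assumes "x \<in> carrier_mat n n" "i < n" "r < n" "c < n"
  shows "(col_subst n i v * x) $$ (r,c) = v r * x $$ (i,c) + (if r = i then 0 else x $$ (r,c))"
proof -
  have "(col_subst n i v * x) $$ (r,c) =
      (\<Sum>k<n. (if k = i then v r * x $$ (i,c) else 0) + (if k = r then if r = i then 0 else x $$ (r,c) else 0))"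
    unfolding index_mult_carrier[OF subst_carrier(1) assms(1,3,4)]
    by (intro sum.cong) (use assms in \<open>auto simp: col_subst_def\<close>)
  then show ?thesis using assms by (simp add: sum.distrib)
qed

lemma mult_row_subst:
  assumes "x \<in> carrier_mat n n" "i < n" "r < n" "c < n"
  shows "(x * row_subst n i v) $$ (r,c) = x $$ (r,i) * v c + (if c = i then 0 else x $$ (r,c))"
proof -
  have "(x * row_subst n i v) $$ (r,c) =
      (\<Sum>k<n. (if k = i then x $$ (r,i) * v c else 0) + (if k = c then if c = i then 0 else x $$ (r,c) else 0))"
    unfolding index_mult_carrier[OF assms(1) subst_carrier(2) assms(3,4)]
    by (intro sum.cong) (use assms in \<open>auto simp: row_subst_def\<close>)
  then show ?thesis using assms by (simp add: sum.distrib)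
qed

lemma col_subst_GLn:
  assumes "i < n" "v i \<noteq> 0" shows "col_subst n i v \<in> GLn n"
proof (rule GLn_I)
  let ?h = "col_subst n i (\<lambda>r. if r = i then 1 / v i else - v r / v i)"
  show "col_subst n i v * ?h = 1\<^sub>m n"
  proof (rule eq_matI)
    fix r c assume "r < dim_row (1\<^sub>m n :: 'a mat)" "c < dim_col (1\<^sub>m n :: 'a mat)"
    then have rc: "r < n" "c < n" by auto
    show "(col_subst n i v * ?h) $$ (r,c) = 1\<^sub>m n $$ (r,c)"
      unfolding col_subst_mult[OF subst_carrier(1) assms(1) rc]
      using assms rc by (auto simp: col_subst_def)
  qed (simp_all add: col_subst_def)
qed auto

lemma row_subst_GLn:
  assumes "i < n" "v i \<noteq> 0" shows "row_subst n i v \<in> GLn n"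
proof (rule GLn_I)
  let ?h = "row_subst n i (\<lambda>r. if r = i then 1 / v i else - v r / v i)"
  show "row_subst n i v * ?h = 1\<^sub>m n"
  proof (rule eq_matI)
    fix r c assume "r < dim_row (1\<^sub>m n :: 'a mat)" "c < dim_col (1\<^sub>m n :: 'a mat)"
    then have rc: "r < n" "c < n" by auto
    show "(row_subst n i v * ?h) $$ (r,c) = 1\<^sub>m n $$ (r,c)"
      unfolding mult_row_subst[OF subst_carrier(2) assms(1) rc]
      using assms rc by (auto simp: row_subst_def)
  qed (simp_all add: row_subst_def)
qed auto

lemma GLn_column_nonzero:
  assumes "h \<in> GLn n" "j < n" shows "\<exists>r<n. h $$ (r,j) \<noteq> 0"
proof (rule ccontr)
  assume "\<not> ?thesis"
  then have z: "h $$ (r,j) = 0" if "r < n" for r using that by blast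
  have "(minv h * h) $$ (j,j) = 0"
    unfolding index_mult_carrier[OF minv_props(1)[OF assms(1)] GLn_carrier[OF assms(1)] assms(2,2)]
    by (intro sum.neutral) (use z in auto)
  then show False using minv_props(3)[OF assms(1)] assms(2) by simp
qed

text \<open>Invariant of the elimination. Clearing the pivot rows, and not only the pivot columns,
  forces the next pivot into a new row and protects the rows already finished.\<close>

definition monomial_upto :: "nat \<Rightarrow> nat \<Rightarrow> (nat \<Rightarrow> nat) \<Rightarrow> 'a::{finite,field} mat \<Rightarrow> bool" where
  "monomial_upto n j \<sigma> h \<longleftrightarrow> (\<forall>c<j. \<sigma> c < n \<and> (\<forall>r<n. h $$ (r,c) = of_bool (r = \<sigma> c)) \<and>
      (\<forall>c'<n. h $$ (\<sigma> c,c') = of_bool (c' = c)))"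

text \<open>The pivot is the lowest nonzero entry of column \<open>j\<close>, so clearing the column
  only changes the pivot row and rows above it, and \<open>p\<close> is upper triangular. The pivot
  row is already zero to the left of column \<open>j\<close>, so clearing it only changes columns
  from \<open>j\<close> on, and \<open>b\<close> is upper triangular too.\<close>

lemma bruhat_step:
  fixes h :: "'a::{finite,field} mat"
  assumes h: "h \<in> GLn n" and j: "j < n" and m: "monomial_upto n j \<sigma> h"
  obtains p b i where "p \<in> GLn n" "b \<in> GLn n" "p \<in> color_parab n (\<lambda>i. i)" "b \<in> color_parab n (\<lambda>i. i)"
    "monomial_upto n (Suc j) (\<sigma>(j := i)) (p * h * b)"
proof -
  have inv: "\<And>c. c < j \<Longrightarrow> \<sigma> c < n"
      "\<And>r c. r < n \<Longrightarrow> c < j \<Longrightarrow> h $$ (r,c) = of_bool (r = \<sigma> c)"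
      "\<And>c c'. c < j \<Longrightarrow> c' < n \<Longrightarrow> h $$ (\<sigma> c,c') = of_bool (c' = c)"
    using m unfolding monomial_upto_def by blast+
  note hc = GLn_carrier[OF h]
  define i where "i = Max {r. r < n \<and> h $$ (r,j) \<noteq> 0}"
  have ne: "{r. r < n \<and> h $$ (r,j) \<noteq> 0} \<noteq> {}" using GLn_column_nonzero[OF h j] by blast
  have fin: "finite {r. r < n \<and> h $$ (r,j) \<noteq> 0}" by simp
  have i: "i < n" "h $$ (i,j) \<noteq> 0" using Max_in[OF fin ne] by (auto simp: i_def)
  have above: "h $$ (r,j) = 0" if "i < r" "r < n" for r
    using Max_ge[OF fin, of r] that unfolding i_def[symmetric] by force
  have i\<sigma>: "i \<noteq> \<sigma> c" if "c < j" for c using inv(3)[OF that j] i(2) that by auto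
  have hic: "h $$ (i,c) = 0" if "c < j" for c using inv(2)[OF i(1) that] i\<sigma>[OF that] by simp
  define v where "v = (\<lambda>r. if r = i then 1 / h $$ (i,j) else - h $$ (r,j) / h $$ (i,j))"
  define p where "p = col_subst n i v"
  define h' where "h' = p * h"
  \<comment> \<open>Adding \<open>w c\<close> times column \<open>j\<close> to column
    \<open>c\<close> clears row \<open>i\<close> outside the pivot, which \<open>p\<close> has
    normalised to 1.\<close>
  define w where "w = (\<lambda>c. if c = j then 1 else - h' $$ (i,c))"
  define b where "b = row_subst n j w"
  have pG: "p \<in> GLn n" unfolding p_def using i by (intro col_subst_GLn) (auto simp: v_def)
  have bG: "b \<in> GLn n" unfolding b_def using j by (intro row_subst_GLn) (auto simp: w_def)
  have h'c: "h' \<in> carrier_mat n n" using hc GLn_carrier[OF pG] by (simp add: h'_def)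
  have h': "h' $$ (r,c) = v r * h $$ (i,c) + (if r = i then 0 else h $$ (r,c))" if "r < n" "c < n" for r c
    unfolding h'_def p_def by (rule col_subst_mult[OF hc i(1) that])
  have h'': "(p * h * b) $$ (r,c) = h' $$ (r,j) * w c + (if c = j then 0 else h' $$ (r,c))" if "r < n" "c < n" for r c
    unfolding h'_def[symmetric] b_def by (rule mult_row_subst[OF h'c j that])
  have A: "h' $$ (r,c) = of_bool (r = \<sigma> c)" if "r < n" "c < j" for r c
    using h'[of r c] that j hic[of c] i\<sigma>[of c] inv(2)[of r c] by auto
  have B: "h' $$ (r,j) = of_bool (r = i)" if "r < n" for r
    using h'[OF that j] i by (simp add: v_def)
  \<comment> \<open>Earlier pivot rows vanish in column \<open>j\<close>, so \<open>p\<close> leaves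
    them unchanged.\<close>
  have v\<sigma>: "v (\<sigma> c) = 0" if "c < j" for c
    using inv(3)[OF that j] i\<sigma>[OF that] that by (auto simp: v_def)
  have C: "h' $$ (\<sigma> c,c') = of_bool (c' = c)" if "c < j" "c' < n" for c c'
    using h'[OF inv(1)[OF that(1)] that(2)] v\<sigma>[OF that(1)] i\<sigma>[OF that(1)] inv(3)[OF that] by simp
  have pU: "p \<in> color_parab n (\<lambda>i. i)"
    unfolding p_def color_parab_def using above by (auto simp: col_subst_def v_def)
  have bU: "b \<in> color_parab n (\<lambda>i. i)"
    unfolding b_def color_parab_def using A[OF i(1)] i\<sigma> by (auto simp: row_subst_def w_def)
  have 1: "(p * h * b) $$ (r,c) = of_bool (r = (\<sigma>(j := i)) c)" if rc: "r < n" "c < Suc j" for r c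
  proof (cases "c = j")
    case True then show ?thesis using h''[OF rc(1) j] B[OF rc(1)] by (simp add: w_def)
  next
    case False
    then have c: "c < j" using rc by simp
    then show ?thesis using h''[of r c] rc j A[OF rc(1) c] A[OF i(1) c] B[OF rc(1)] i\<sigma>[OF c] by (auto simp: w_def)
  qed
  have 2: "(p * h * b) $$ ((\<sigma>(j := i)) c,c') = of_bool (c' = c)" if c: "c < Suc j" "c' < n" for c c'
  proof (cases "c = j")
    case True then show ?thesis using h''[OF i(1) c(2)] B[OF i(1)] by (simp add: w_def)
  next
    case False
    then have c1: "c < j" using c by simp
    have "\<sigma> c \<noteq> i" using i\<sigma>[OF c1] by simp
    then show ?thesis
      using h''[OF inv(1)[OF c1] c(2)] B[OF inv(1)[OF c1]] C[OF c1 c(2)] False c1 by auto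
  qed
  have 3: "(\<sigma>(j := i)) c < n" if "c < Suc j" for c
    using that inv(1)[of c] i(1) by (cases "c = j") auto
  show thesis
    by (rule that[OF pG bG pU bU]) (unfold monomial_upto_def, use 1 2 3 in blast)
qed

lemma bruhat_partial:
  assumes g: "g \<in> GLn n"
  shows "j \<le> n \<Longrightarrow> \<exists>p b \<sigma>. p \<in> GLn n \<and> p \<in> color_parab n (\<lambda>i. i) \<and> b \<in> GLn n \<and> b \<in> color_parab n (\<lambda>i. i) \<and>
    monomial_upto n j \<sigma> (p * g * b)"
proof (induction j)
  case 0
  have "monomial_upto n 0 id (1\<^sub>m n * g * 1\<^sub>m n)" by (simp add: monomial_upto_def)
  then show ?case using one_GLn one_color_parab by blast
next
  case (Suc j)
  then obtain p b \<sigma> where p: "p \<in> GLn n" "p \<in> color_parab n (\<lambda>i. i)"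
    and b: "b \<in> GLn n" "b \<in> color_parab n (\<lambda>i. i)" and m: "monomial_upto n j \<sigma> (p * g * b)"
    by (metis Suc_leD)
  have h: "p * g * b \<in> GLn n" using p b g by (intro mult_GLn)
  from Suc.prems have j: "j < n" by simp
  obtain p' b' i where p': "p' \<in> GLn n" and b': "b' \<in> GLn n"
    and u: "p' \<in> color_parab n (\<lambda>i. i)" "b' \<in> color_parab n (\<lambda>i. i)"
    and m': "monomial_upto n (Suc j) (\<sigma>(j := i)) (p' * (p * g * b) * b')"
    by (rule bruhat_step[OF h j m])
  have "p' * (p * g * b) * b' = (p' * p) * g * (b * b')"
    using GLn_carrier[OF p(1)] GLn_carrier[OF p'(1)] GLn_carrier[OF b(1)] GLn_carrier[OF b'(1)] GLn_carrier[OF g]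
    by (simp add: assoc_mult_mat[of _ n n _ n _ n] mult_carrier_mat[of _ n n _ n])
  with m' have "monomial_upto n (Suc j) (\<sigma>(j := i)) ((p' * p) * g * (b * b'))" by simp
  moreover have "p' * p \<in> GLn n" "b * b' \<in> GLn n"
    using p p' b b' by (auto intro: mult_GLn)
  moreover have "p' * p \<in> color_parab n (\<lambda>i. i)" "b * b' \<in> color_parab n (\<lambda>i. i)"
    using p u b by (auto intro: color_parab_mult)
  ultimately show ?case by blast
qed

lemma bruhat:
  assumes g: "(g :: 'a::{finite,field} mat) \<in> GLn n"
  obtains p b \<tau> where "p \<in> GLn n" "p \<in> color_parab n (\<lambda>i. i)" "b \<in> GLn n" "b \<in> color_parab n (\<lambda>i. i)"
    "bij_betw \<tau> {..<n} {..<n}" "p * g * b = perm_mat n \<tau>"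
proof -
  obtain p b \<sigma> where p: "p \<in> GLn n" "p \<in> color_parab n (\<lambda>i. i)"
    and b: "b \<in> GLn n" "b \<in> color_parab n (\<lambda>i. i)" and m: "monomial_upto n n \<sigma> (p * g * b)"
    using bruhat_partial[OF g, of n] by auto
  note inv = m[unfolded monomial_upto_def]
  have inj: "inj_on \<sigma> {..<n}"
  proof (rule inj_onI)
    fix c c' assume c: "c \<in> {..<n}" "c' \<in> {..<n}" "\<sigma> c = \<sigma> c'"
    have e: "(p * g * b) $$ (\<sigma> c,c') = of_bool (c' = c)" "(p * g * b) $$ (\<sigma> c',c') = of_bool (c' = c')"
      using inv c(1,2) by blast+
    have "(of_bool (c' = c) :: 'a) = of_bool (c' = c')"
      using e(1) unfolding c(3) e(2) by (rule sym)
    then show "c = c'" by (simp split: if_splits)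
  qed
  have bij: "bij_betw \<sigma> {..<n} {..<n}"
    using inj inv by (intro bij_betw_imageI endo_inj_surj) auto
  \<comment> \<open>\<open>monomial_upto\<close> records the row of the 1 in each column,
    \<open>perm_mat\<close> the column of the 1 in each row; hence the inverse permutation.\<close>
  define \<tau> where "\<tau> = inv_into {..<n} \<sigma>"
  have t: "bij_betw \<tau> {..<n} {..<n}" unfolding \<tau>_def by (rule bij_betw_inv_into[OF bij])
  have "p * g * b = perm_mat n \<tau>"
  proof (rule eq_matI)
    fix r c assume "r < dim_row (perm_mat n \<tau> :: 'a mat)" "c < dim_col (perm_mat n \<tau> :: 'a mat)"
    then have rc: "r < n" "c < n" by (simp_all add: perm_mat_def)
    then have "(r = \<sigma> c) = (c = \<tau> r)"
      using bij_betw_inv_into_left[OF bij, of c] bij_betw_inv_into_right[OF bij, of r] by (auto simp: \<tau>_def)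
    then show "(p * g * b) $$ (r,c) = perm_mat n \<tau> $$ (r,c)" using inv rc by (simp add: perm_mat_def)
  qed (use GLn_carrier[OF p(1)] GLn_carrier[OF b(1)] in \<open>simp_all add: perm_mat_def\<close>)
  then show thesis using that p b t by blast
qed

subsection \<open>Class averages\<close>

text \<open>Up to the factor |GL_n| this is the orthogonal projection onto class functions. The
  missing normalisation is the source of the group orders in later constants.\<close>

definition class_avg :: "nat \<Rightarrow> ('a::{finite,field} mat \<Rightarrow> complex) \<Rightarrow> 'a mat \<Rightarrow> complex" where
  "class_avg n \<phi> x = (if x \<in> carrier_mat n n then \<Sum>g\<in>GLn n. \<phi> (conjm g x) else 0)"

lemma classfun_conjm: "f \<in> classfun n \<Longrightarrow> g \<in> GLn n \<Longrightarrow> x \<in> carrier_mat n n \<Longrightarrow> f (conjm g x) = f x"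
  unfolding classfun_def by blast

lemma classfun_outside: "f \<in> classfun n \<Longrightarrow> x \<notin> carrier_mat n n \<Longrightarrow> f x = 0"
  unfolding classfun_def by blast

lemma classfun_zero: "(\<lambda>_. 0) \<in> classfun n"
  by (simp add: classfun_def)

lemma classfun_lin: "f \<in> classfun n \<Longrightarrow> h \<in> classfun n \<Longrightarrow> (\<lambda>x. c * f x + h x) \<in> classfun n"
  by (simp add: classfun_def)

lemma classfun_add: "f \<in> classfun n \<Longrightarrow> h \<in> classfun n \<Longrightarrow> (\<lambda>x. f x + h x) \<in> classfun n"
  by (simp add: classfun_def)

lemma classfun_scale: "f \<in> classfun n \<Longrightarrow> (\<lambda>x. c * f x) \<in> classfun n"
  by (simp add: classfun_def)

lemma classfun_sum:
  "(\<And>k. k \<in> K \<Longrightarrow> a k \<in> classfun n) \<Longrightarrow> (\<lambda>x. \<Sum>k\<in>K. a k x) \<in> classfun n"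
  unfolding classfun_def by (auto intro!: sum.cong)

lemma class_avg_classfun: "class_avg n \<phi> \<in> classfun n"
proof -
  have "class_avg n \<phi> (conjm h x) = class_avg n \<phi> x"
    if h: "h \<in> GLn n" and x: "x \<in> carrier_mat n n" for h x
  proof -
    have "class_avg n \<phi> (conjm h x) = (\<Sum>g\<in>GLn n. \<phi> (conjm (g * h) x))"
      using h x by (auto simp: class_avg_def conjm_mult intro!: sum.cong)
    also have "\<dots> = (\<Sum>g\<in>GLn n. \<phi> (conjm g x))"
      by (rule sum.reindex_bij_betw[OF bij_GLn_mult_right[OF h], of "\<lambda>g. \<phi> (conjm g x)"])
    finally show ?thesis using x by (simp add: class_avg_def)
  qed
  then show ?thesis unfolding classfun_def by (auto simp: class_avg_def)
qed

text \<open>Invariance of \<open>f\<close> lets each conjugation be moved from \<open>\<phi>\<close>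
  to \<open>f\<close>, where it disappears; each of the |GL_n| summands then contributes
  equally.\<close>

lemma sum_classfun_avg:
  assumes f: "f \<in> classfun n"
  shows "(\<Sum>x\<in>carrier_mat n n. f x * cnj (class_avg n \<phi> x)) =
    of_nat (card (GLn n :: 'a::{finite,field} mat set)) * (\<Sum>x\<in>carrier_mat n n. f x * cnj (\<phi> (x :: 'a mat)))"
proof -
  have "(\<Sum>x\<in>carrier_mat n n. f x * cnj (class_avg n \<phi> x)) =
      (\<Sum>x\<in>carrier_mat n n. \<Sum>g\<in>GLn n. f x * cnj (\<phi> (conjm g x)))"
    by (simp add: class_avg_def sum_distrib_left)
  also have "\<dots> = (\<Sum>g\<in>GLn n. \<Sum>x\<in>carrier_mat n n. f x * cnj (\<phi> (conjm g x)))"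
    by (rule sum.swap)
  also have "\<dots> = (\<Sum>g\<in>(GLn n :: 'a mat set). \<Sum>x\<in>carrier_mat n n. f x * cnj (\<phi> x))"
  proof (rule sum.cong[OF refl])
    fix g :: "'a mat" assume g: "g \<in> GLn n"
    have "(\<Sum>x\<in>carrier_mat n n. f x * cnj (\<phi> (conjm g x))) =
        (\<Sum>x\<in>carrier_mat n n. f (conjm g x) * cnj (\<phi> (conjm g x)))"
      using classfun_conjm[OF f g] by (intro sum.cong) auto
    also have "\<dots> = (\<Sum>x\<in>carrier_mat n n. f x * cnj (\<phi> x))"
      by (rule sum.reindex_bij_betw[OF bij_conjm[OF g], of "\<lambda>x. f x * cnj (\<phi> x)"])
    finally show "(\<Sum>x\<in>carrier_mat n n. f x * cnj (\<phi> (conjm g x))) = (\<Sum>x\<in>carrier_mat n n. f x * cnj (\<phi> x))" .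
  qed
  finally show ?thesis by simp
qed

lemma GLn_nonempty [simp]: "GLn n \<noteq> ({} :: 'a::{finite,field} mat set)"
  using one_GLn by blast

subsection \<open>The two-block parabolic\<close>

definition two_block :: "nat \<Rightarrow> nat \<Rightarrow> nat" where
  "two_block n1 i = (if i < n1 then 0 else 1)"

definition ul_block :: "nat \<Rightarrow> 'a::{finite,field} mat \<Rightarrow> 'a mat" where
  "ul_block n1 x = mat n1 n1 (\<lambda>(i,j). x $$ (i,j))"

definition lr_block :: "nat \<Rightarrow> nat \<Rightarrow> 'a::{finite,field} mat \<Rightarrow> 'a mat" where
  "lr_block n1 n2 x = mat n2 n2 (\<lambda>(i,j). x $$ (i + n1, j + n1))"

definition diag_block :: "nat \<Rightarrow> nat \<Rightarrow> 'a::{finite,field} mat \<Rightarrow> 'a mat \<Rightarrow> 'a mat" where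
  "diag_block n1 n2 x y = mat (n1+n2) (n1+n2) (\<lambda>(i,j).
     if i < n1 \<and> j < n1 then x $$ (i,j) else if i \<ge> n1 \<and> j \<ge> n1 then y $$ (i - n1, j - n1) else 0)"

lemma block_carrier [simp]: "ul_block n1 x \<in> carrier_mat n1 n1" "lr_block n1 n2 x \<in> carrier_mat n2 n2"
  "diag_block n1 n2 y z \<in> carrier_mat (n1+n2) (n1+n2)"
  by (simp_all add: ul_block_def lr_block_def diag_block_def)

lemma ul_block_diag [simp]: "x \<in> carrier_mat n1 n1 \<Longrightarrow> ul_block n1 (diag_block n1 n2 x y) = x"
  by (intro eq_matI) (auto simp: ul_block_def diag_block_def)

lemma lr_block_diag [simp]: "y \<in> carrier_mat n2 n2 \<Longrightarrow> lr_block n1 n2 (diag_block n1 n2 x y) = y"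
  by (intro eq_matI) (auto simp: lr_block_def diag_block_def)

lemma diag_block_parab [simp]: "diag_block n1 n2 x y \<in> color_parab (n1+n2) (two_block n1)"
  by (auto simp: color_parab_def two_block_def diag_block_def)

lemma two_block_parab_0:
  "x \<in> color_parab (n1+n2) (two_block n1) \<Longrightarrow> n1 \<le> i \<Longrightarrow> i < n1+n2 \<Longrightarrow> j < n1 \<Longrightarrow> x $$ (i,j) = 0"
  by (auto simp: color_parab_def two_block_def)

text \<open>The vanishing lower left block cuts the sum over the middle index to the first
  \<open>n1\<close> values. Together with \<open>lr_block_mult\<close> this says that projecting the
  parabolic algebra to its Levi quotient is multiplicative.\<close>

lemma ul_block_mult:
  assumes "x \<in> color_parab (n1+n2) (two_block n1)" "y \<in> color_parab (n1+n2) (two_block n1)"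
  shows "ul_block n1 (x * y) = ul_block n1 x * ul_block n1 y"
proof (rule eq_matI)
  note c = color_parab_carrier[OF assms(1)] color_parab_carrier[OF assms(2)]
  fix i j assume "i < dim_row (ul_block n1 x * ul_block n1 y)" "j < dim_col (ul_block n1 x * ul_block n1 y)"
  then have ij: "i < n1" "j < n1" by (simp_all add: ul_block_def)
  have "(x * y) $$ (i,j) = (\<Sum>k<n1+n2. x $$ (i,k) * y $$ (k,j))"
    by (rule index_mult_carrier[OF c]) (use ij in auto)
  also have "\<dots> = (\<Sum>k<n1. x $$ (i,k) * y $$ (k,j))"
  proof (rule sum.mono_neutral_right)
    show "\<forall>k\<in>{..<n1 + n2} - {..<n1}. x $$ (i,k) * y $$ (k,j) = 0"
      using two_block_parab_0[OF assms(2)] ij by auto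
  qed auto
  also have "\<dots> = (ul_block n1 x * ul_block n1 y) $$ (i,j)"
    unfolding index_mult_carrier[OF block_carrier(1) block_carrier(1) ij]
    by (intro sum.cong) (use ij in \<open>auto simp: ul_block_def\<close>)
  finally show "ul_block n1 (x * y) $$ (i,j) = (ul_block n1 x * ul_block n1 y) $$ (i,j)"
    using ij by (simp add: ul_block_def del: index_mult_mat)
qed (simp_all add: ul_block_def)

lemma lr_block_mult:
  assumes "x \<in> color_parab (n1+n2) (two_block n1)" "y \<in> color_parab (n1+n2) (two_block n1)"
  shows "lr_block n1 n2 (x * y) = lr_block n1 n2 x * lr_block n1 n2 y"
proof (rule eq_matI)
  note c = color_parab_carrier[OF assms(1)] color_parab_carrier[OF assms(2)]
  fix i j assume "i < dim_row (lr_block n1 n2 x * lr_block n1 n2 y)" "j < dim_col (lr_block n1 n2 x * lr_block n1 n2 y)"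
  then have ij: "i < n2" "j < n2" by (simp_all add: lr_block_def)
  have "(x * y) $$ (i + n1,j + n1) = (\<Sum>k<n1+n2. x $$ (i + n1,k) * y $$ (k,j + n1))"
    by (rule index_mult_carrier[OF c]) (use ij in auto)
  also have "\<dots> = (\<Sum>k\<in>{n1..<n1+n2}. x $$ (i + n1,k) * y $$ (k,j + n1))"
  proof (rule sum.mono_neutral_right)
    show "\<forall>k\<in>{..<n1 + n2} - {n1..<n1+n2}. x $$ (i + n1,k) * y $$ (k,j + n1) = 0"
      using two_block_parab_0[OF assms(1), of "i + n1"] ij by auto
  qed auto
  also have "\<dots> = (\<Sum>k<n2. x $$ (i + n1,k + n1) * y $$ (k + n1,j + n1))"
    using sum.shift_bounds_nat_ivl[of "\<lambda>k. x $$ (i + n1,k) * y $$ (k,j + n1)" 0 n1 n2]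
    by (simp add: atLeast0LessThan add.commute)
  also have "\<dots> = (lr_block n1 n2 x * lr_block n1 n2 y) $$ (i,j)"
    unfolding index_mult_carrier[OF block_carrier(2) block_carrier(2) ij]
    by (intro sum.cong) (use ij in \<open>auto simp: lr_block_def\<close>)
  finally show "lr_block n1 n2 (x * y) $$ (i,j) = (lr_block n1 n2 x * lr_block n1 n2 y) $$ (i,j)"
    using ij by (simp add: lr_block_def del: index_mult_mat)
qed (simp_all add: lr_block_def)

lemma block_one [simp]: "ul_block n1 (1\<^sub>m (n1+n2)) = (1\<^sub>m n1 :: 'a::{finite,field} mat)"
  "lr_block n1 n2 (1\<^sub>m (n1+n2)) = (1\<^sub>m n2 :: 'a::{finite,field} mat)"
  by (auto intro!: eq_matI simp: ul_block_def lr_block_def)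

lemma block_GLn:
  assumes "p \<in> GLn (n1+n2)" "p \<in> color_parab (n1+n2) (two_block n1)"
  shows "ul_block n1 p \<in> GLn n1" "minv (ul_block n1 p) = ul_block n1 (minv p)"
    and "lr_block n1 n2 p \<in> GLn n2" "minv (lr_block n1 n2 p) = lr_block n1 n2 (minv p)"
proof -
  note q = minv_color_parab[OF assms(2,1)] minv_props[OF assms(1)]
  have 1: "ul_block n1 p * ul_block n1 (minv p) = 1\<^sub>m n1"
    using ul_block_mult[OF assms(2) q(1)] q(3) by simp
  have 2: "lr_block n1 n2 p * lr_block n1 n2 (minv p) = 1\<^sub>m n2"
    using lr_block_mult[OF assms(2) q(1)] q(3) by simp
  show 3: "ul_block n1 p \<in> GLn n1" by (rule GLn_I[OF _ _ 1]) auto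
  show 4: "lr_block n1 n2 p \<in> GLn n2" by (rule GLn_I[OF _ _ 2]) auto
  show "minv (ul_block n1 p) = ul_block n1 (minv p)" by (rule minv_unique[OF 3 _ 1]) simp
  show "minv (lr_block n1 n2 p) = lr_block n1 n2 (minv p)" by (rule minv_unique[OF 4 _ 2]) simp
qed

lemma block_conjm:
  assumes "p \<in> GLn (n1+n2)" "p \<in> color_parab (n1+n2) (two_block n1)" "x \<in> color_parab (n1+n2) (two_block n1)"
  shows "ul_block n1 (conjm p x) = conjm (ul_block n1 p) (ul_block n1 x)"
    and "lr_block n1 n2 (conjm p x) = conjm (lr_block n1 n2 p) (lr_block n1 n2 x)"
proof -
  note px = color_parab_mult[OF assms(2,3)] and q = minv_color_parab[OF assms(2,1)]
  show "ul_block n1 (conjm p x) = conjm (ul_block n1 p) (ul_block n1 x)"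
    unfolding conjm_def block_GLn(2)[OF assms(1,2)] ul_block_mult[OF px q] ul_block_mult[OF assms(2,3)] ..
  show "lr_block n1 n2 (conjm p x) = conjm (lr_block n1 n2 p) (lr_block n1 n2 x)"
    unfolding conjm_def block_GLn(4)[OF assms(1,2)] lr_block_mult[OF px q] lr_block_mult[OF assms(2,3)] ..
qed

lemma conjm_parab_iff:
  assumes "p \<in> GLn n" "p \<in> color_parab n \<beta>" "x \<in> carrier_mat n n"
  shows "conjm p x \<in> color_parab n \<beta> \<longleftrightarrow> x \<in> color_parab n \<beta>"
  using conjm_color_parab[OF assms(2,1)] conjm_color_parab[OF minv_color_parab[OF assms(2,1)] minv_GLn[OF assms(1)]]
    conjm_minv(1)[OF assms(1,3)] by metis

lemma diag_block_mult:
  assumes "a \<in> carrier_mat n1 n1" "b \<in> carrier_mat n2 n2" "c \<in> carrier_mat n1 n1" "d \<in> carrier_mat n2 n2"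
  shows "diag_block n1 n2 a b * diag_block n1 n2 c d = diag_block n1 n2 (a * c) (b * d)"
proof (rule eq_matI)
  let ?x = "diag_block n1 n2 a b" and ?y = "diag_block n1 n2 c d"
  have P: "ul_block n1 (?x * ?y) = a * c" "lr_block n1 n2 (?x * ?y) = b * d"
    using assms by (simp_all add: ul_block_mult[of _ n1 n2] lr_block_mult)
  fix i j assume "i < dim_row (diag_block n1 n2 (a * c) (b * d))" "j < dim_col (diag_block n1 n2 (a * c) (b * d))"
  then have ij: "i < n1 + n2" "j < n1 + n2" by (simp_all add: diag_block_def)
  consider "i < n1" "j < n1" | "i \<ge> n1" "j \<ge> n1" | "(i < n1) \<noteq> (j < n1)" by linarith
  then show "(?x * ?y) $$ (i,j) = diag_block n1 n2 (a * c) (b * d) $$ (i,j)"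
  proof cases
    case 1
    have "(?x * ?y) $$ (i,j) = ul_block n1 (?x * ?y) $$ (i,j)"
      using 1 by (simp add: ul_block_def del: index_mult_mat)
    then show ?thesis unfolding P using 1 ij by (simp add: diag_block_def del: index_mult_mat)
  next
    case 2
    then have "(?x * ?y) $$ (i,j) = lr_block n1 n2 (?x * ?y) $$ (i - n1,j - n1)"
      using ij by (simp add: lr_block_def del: index_mult_mat)
    then show ?thesis unfolding P using 2 ij by (simp add: diag_block_def del: index_mult_mat)
  next
    case 3
    have "(?x * ?y) $$ (i,j) = (\<Sum>k<n1+n2. ?x $$ (i,k) * ?y $$ (k,j))"
      by (rule index_mult_carrier[OF block_carrier(3) block_carrier(3) ij])
    also have "\<dots> = 0" using 3 ij by (intro sum.neutral) (auto simp: diag_block_def)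
    finally show ?thesis using 3 ij by (auto simp add: diag_block_def simp del: index_mult_mat)
  qed
qed (simp_all add: diag_block_def)

lemma diag_block_GLn:
  assumes "a \<in> GLn n1" "b \<in> GLn n2"
  shows "diag_block n1 n2 a b \<in> GLn (n1+n2)"
proof (rule GLn_I[OF block_carrier(3) block_carrier(3)])
  note q = minv_props[OF assms(1)] minv_props[OF assms(2)] GLn_carrier[OF assms(1)] GLn_carrier[OF assms(2)]
  show "diag_block n1 n2 a b * diag_block n1 n2 (minv a) (minv b) = 1\<^sub>m (n1+n2)"
    using q by (simp add: diag_block_mult) (intro eq_matI; auto simp: diag_block_def)
qed

subsection \<open>Harish-Chandra induction\<close>

text \<open>Inflation of the external product along the Levi projection, extended by zero off the
  parabolic. Harish-Chandra induction is its class average divided by the order of the parabolic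
  group, and this is the form in which induction is handled from here on.\<close>

definition parab_ext :: "nat \<Rightarrow> nat \<Rightarrow> ('a::{finite,field} mat \<Rightarrow> complex) \<Rightarrow> ('a mat \<Rightarrow> complex) \<Rightarrow> 'a mat \<Rightarrow> complex" where
  "parab_ext n1 n2 f1 f2 x = (if x \<in> color_parab (n1+n2) (two_block n1)
     then f1 (ul_block n1 x) * f2 (lr_block n1 n2 x) else 0)"

lemma blk_two: "i < n1 + n2 \<Longrightarrow> blk [n1,n2] i = two_block n1 i"
proof -
  assume i: "i < n1 + n2"
  have "{k. k < length [n1,n2] \<and> sum_list (take (Suc k) [n1,n2]) \<le> i} = (if i < n1 then {} else {0})"
    using i by (auto simp: less_Suc_eq)
  then show ?thesis by (simp add: blk_def two_block_def)
qed

lemma parab_alg_eq: "parab_alg ns = color_parab (sum_list ns) (blk ns)"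
  by (auto simp: parab_alg_def color_parab_def)

lemma unip_alg_eq: "unip_alg ns = color_nil (sum_list ns) (blk ns)"
  by (auto simp: unip_alg_def color_nil_def)

lemma color_parab_cong: "(\<And>i. i < n \<Longrightarrow> \<beta> i = \<gamma> i) \<Longrightarrow> color_parab n \<beta> = color_parab n \<gamma>"
  unfolding color_parab_def by auto

lemma parab_alg_two: "parab_alg [n1,n2] = color_parab (n1+n2) (two_block n1)"
  unfolding parab_alg_eq using color_parab_cong[of "n1+n2" "blk [n1,n2]" "two_block n1"] blk_two by simp

lemma ext_prod_levi_proj:
  assumes "x \<in> carrier_mat (n1+n2) (n1+n2)"
  shows "ext_prod n1 n2 f1 f2 (levi_proj [n1,n2] x) = f1 (ul_block n1 x) * f2 (lr_block n1 n2 x)"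
proof -
  have "mat n1 n1 (\<lambda>(i,j). levi_proj [n1,n2] x $$ (i,j)) = ul_block n1 x"
    using assms by (intro eq_matI) (auto simp: ul_block_def levi_proj_def blk_two two_block_def)
  moreover have "mat n2 n2 (\<lambda>(i,j). levi_proj [n1,n2] x $$ (i + n1,j + n1)) = lr_block n1 n2 x"
    using assms by (intro eq_matI) (auto simp: lr_block_def levi_proj_def blk_two two_block_def)
  ultimately show ?thesis by (simp add: ext_prod_def)
qed

lemma HC_ind_eq:
  "HC_ind n1 n2 (ext_prod n1 n2 f1 f2) =
   (\<lambda>x. 1 / of_nat (card (parab_grp [n1,n2] :: 'a::{finite,field} mat set)) * class_avg (n1+n2) (parab_ext n1 n2 f1 f2) (x :: 'a mat))"
proof
  fix x :: "'a mat"
  show "HC_ind n1 n2 (ext_prod n1 n2 f1 f2) x =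
   1 / of_nat (card (parab_grp [n1,n2] :: 'a mat set)) * class_avg (n1+n2) (parab_ext n1 n2 f1 f2) x"
  proof (cases "x \<in> carrier_mat (n1+n2) (n1+n2)")
    case True
    have "(\<Sum>g \<in> {g \<in> GLn (n1+n2). conjm g x \<in> parab_alg [n1,n2]}. ext_prod n1 n2 f1 f2 (levi_proj [n1,n2] (conjm g x)))
      = (\<Sum>g\<in>GLn (n1+n2). if conjm g x \<in> parab_alg [n1,n2] then ext_prod n1 n2 f1 f2 (levi_proj [n1,n2] (conjm g x)) else 0)"
      by (rule sum.inter_filter) simp
    also have "\<dots> = (\<Sum>g\<in>GLn (n1+n2). parab_ext n1 n2 f1 f2 (conjm g x))"
      by (intro sum.cong refl) (simp add: parab_ext_def parab_alg_two ext_prod_levi_proj True)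
    finally show ?thesis using True by (simp add: HC_ind_def class_avg_def)
  next
    case False
    then show ?thesis by (simp only: HC_ind_def class_avg_def if_False mult_zero_right)
  qed
qed

lemma HC_ind_classfun: "HC_ind n1 n2 (ext_prod n1 n2 f1 f2) \<in> classfun (n1+n2)"
  unfolding HC_ind_eq by (intro classfun_scale class_avg_classfun)

lemma parab_grp_card_pos: "card (parab_grp [n1,n2] :: 'a::{finite,field} mat set) > 0"
proof -
  have "1\<^sub>m (n1+n2) \<in> (parab_grp [n1,n2] :: 'a mat set)"
    unfolding parab_grp_def parab_alg_two by simp
  moreover have "finite (parab_grp [n1,n2] :: 'a mat set)"
    unfolding parab_grp_def by simp
  ultimately show ?thesis using card_gt_0_iff by blast
qed

text \<open>Averaging over the two small groups is redundant: block diagonal matrices preserve the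
  parabolic, act blockwise through the inflation, and are absorbed by the substitution of
  \<open>diag_block n1 n2 a b * g\<close> for \<open>g\<close> in the big average. Only the group
  orders remain.\<close>

lemma HC_ind_class_avg:
  "HC_ind n1 n2 (ext_prod n1 n2 (class_avg n1 \<phi>1) (class_avg n2 \<phi>2)) =
   (\<lambda>x. of_nat (card (GLn n1 :: 'a mat set)) * of_nat (card (GLn n2 :: 'a mat set)) /
     of_nat (card (parab_grp [n1,n2] :: 'a::{finite,field} mat set)) * class_avg (n1+n2) (parab_ext n1 n2 \<phi>1 \<phi>2) (x :: 'a mat))"
proof -
  let ?G = "GLn (n1+n2) :: 'a mat set" and ?P = "color_parab (n1+n2) (two_block n1) :: 'a mat set"
  have "class_avg (n1+n2) (parab_ext n1 n2 (class_avg n1 \<phi>1) (class_avg n2 \<phi>2)) x =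
      of_nat (card (GLn n1 :: 'a mat set)) * of_nat (card (GLn n2 :: 'a mat set)) * class_avg (n1+n2) (parab_ext n1 n2 \<phi>1 \<phi>2) x"
    if x: "x \<in> carrier_mat (n1+n2) (n1+n2)" for x :: "'a mat"
  proof -
    have 1: "parab_ext n1 n2 (class_avg n1 \<phi>1) (class_avg n2 \<phi>2) y =
        (\<Sum>a\<in>GLn n1. \<Sum>b\<in>GLn n2. parab_ext n1 n2 \<phi>1 \<phi>2 (conjm (diag_block n1 n2 a b) y))"
      if y: "y \<in> carrier_mat (n1+n2) (n1+n2)" for y :: "'a mat"
    proof (cases "y \<in> ?P")
      case True
      have "parab_ext n1 n2 \<phi>1 \<phi>2 (conjm (diag_block n1 n2 a b) y) = \<phi>1 (conjm a (ul_block n1 y)) * \<phi>2 (conjm b (lr_block n1 n2 y))"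
        if "a \<in> GLn n1" "b \<in> GLn n2" for a b
        using that True diag_block_GLn[OF that] conjm_parab_iff[OF diag_block_GLn[OF that] diag_block_parab y]
          block_conjm[OF diag_block_GLn[OF that] diag_block_parab True]
        by (simp add: parab_ext_def)
      then show ?thesis using True by (simp add: parab_ext_def class_avg_def sum_product)
    next
      case False
      have "parab_ext n1 n2 \<phi>1 \<phi>2 (conjm (diag_block n1 n2 a b) y) = 0"
        if "a \<in> GLn n1" "b \<in> GLn n2" for a b
        using False conjm_parab_iff[OF diag_block_GLn[OF that] diag_block_parab y] by (simp add: parab_ext_def)
      then show ?thesis using False by (simp add: parab_ext_def)
    qed
    have "class_avg (n1+n2) (parab_ext n1 n2 (class_avg n1 \<phi>1) (class_avg n2 \<phi>2)) x =
       (\<Sum>g\<in>?G. \<Sum>a\<in>GLn n1. \<Sum>b\<in>GLn n2. parab_ext n1 n2 \<phi>1 \<phi>2 (conjm (diag_block n1 n2 a b) (conjm g x)))"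
      using x by (simp add: class_avg_def 1)
    also have "\<dots> = (\<Sum>a\<in>GLn n1. \<Sum>g\<in>?G. \<Sum>b\<in>GLn n2. parab_ext n1 n2 \<phi>1 \<phi>2 (conjm (diag_block n1 n2 a b) (conjm g x)))"
      by (rule sum.swap)
    also have "\<dots> = (\<Sum>a\<in>GLn n1. \<Sum>b\<in>GLn n2. \<Sum>g\<in>?G. parab_ext n1 n2 \<phi>1 \<phi>2 (conjm (diag_block n1 n2 a b) (conjm g x)))"
      by (intro sum.cong refl sum.swap)
    also have "\<dots> = (\<Sum>a\<in>(GLn n1 :: 'a mat set). \<Sum>b\<in>(GLn n2 :: 'a mat set). class_avg (n1+n2) (parab_ext n1 n2 \<phi>1 \<phi>2) x)"
    proof (intro sum.cong refl)
      fix a b :: "'a mat" assume "a \<in> GLn n1" "b \<in> GLn n2"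
      then have d: "diag_block n1 n2 a b \<in> ?G" by (rule diag_block_GLn)
      have "(\<Sum>g\<in>?G. parab_ext n1 n2 \<phi>1 \<phi>2 (conjm (diag_block n1 n2 a b) (conjm g x))) =
          (\<Sum>g\<in>?G. parab_ext n1 n2 \<phi>1 \<phi>2 (conjm (diag_block n1 n2 a b * g) x))"
        using d x by (simp add: conjm_mult)
      also have "\<dots> = (\<Sum>g\<in>?G. parab_ext n1 n2 \<phi>1 \<phi>2 (conjm g x))"
        by (rule sum.reindex_bij_betw[OF bij_GLn_mult_left[OF d], of "\<lambda>g. parab_ext n1 n2 \<phi>1 \<phi>2 (conjm g x)"])
      finally show "(\<Sum>g\<in>?G. parab_ext n1 n2 \<phi>1 \<phi>2 (conjm (diag_block n1 n2 a b) (conjm g x))) = class_avg (n1+n2) (parab_ext n1 n2 \<phi>1 \<phi>2) x"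
        using x by (simp add: class_avg_def)
    qed
    finally show ?thesis by simp
  qed
  then have "class_avg (n1+n2) (parab_ext n1 n2 (class_avg n1 \<phi>1) (class_avg n2 \<phi>2)) =
      (\<lambda>x. of_nat (card (GLn n1 :: 'a mat set)) * of_nat (card (GLn n2 :: 'a mat set)) * class_avg (n1+n2) (parab_ext n1 n2 \<phi>1 \<phi>2) x)"
    by (intro ext) (simp add: class_avg_def)
  then show ?thesis unfolding HC_ind_eq by (simp add: fun_eq_iff)
qed

subsection \<open>The filtration by vanishing coset sums\<close>

text \<open>The number of blocks is the number of colours actually used on the indices below
  \<open>n\<close>. Every parabolic is conjugate to a coloured one, so for class functions these
  tests cover all of them.\<close>

definition coset_fil :: "nat \<Rightarrow> nat \<Rightarrow> ('a::{finite,field} mat \<Rightarrow> complex) set" where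
  "coset_fil n k = {f \<in> classfun n. \<forall>\<beta>. \<forall>x \<in> color_parab n \<beta>. k < card (\<beta> ` {..<n}) \<longrightarrow>
     (\<Sum>y \<in> color_coset n \<beta> x. f y) = 0}"

definition coset_avg :: "nat \<Rightarrow> (nat \<Rightarrow> nat) \<Rightarrow> 'a::{finite,field} mat \<Rightarrow> 'a mat \<Rightarrow> complex" where
  "coset_avg n \<beta> x = class_avg n (\<lambda>y. of_bool (y \<in> color_coset n \<beta> x))"

definition coset_gens :: "nat \<Rightarrow> nat \<Rightarrow> ('a::{finite,field} mat \<Rightarrow> complex) set" where
  "coset_gens n k = {coset_avg n \<beta> x | \<beta> x. x \<in> color_parab n \<beta> \<and> k \<le> card (\<beta> ` {..<n})}"

lemma sort_colors:
  fixes \<beta> :: "nat \<Rightarrow> nat"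
  obtains \<sigma> where "bij_betw \<sigma> {..<n} {..<n}" "\<And>i j. i \<le> j \<Longrightarrow> j < n \<Longrightarrow> (\<beta> (\<sigma> i) :: nat) \<le> \<beta> (\<sigma> j)"
proof -
  let ?xs = "sort_key \<beta> [0..<n]"
  have "bij_betw ((!) ?xs) {..<n} {..<n}" by (rule bij_betw_nth) auto
  moreover have "sorted (map \<beta> ?xs)" by (rule sorted_sort_key)
  then have "\<beta> (?xs ! i) \<le> \<beta> (?xs ! j)" if "i \<le> j" "j < n" for i j
    using sorted_nth_mono[of "map \<beta> ?xs" i j] that by simp
  ultimately show thesis using that by blast
qed

text \<open>Sorting the indices by colour is conjugation by a permutation matrix, invisible to a
  class function. Monotone colourings are what the Bruhat argument needs, because their parabolics
  contain the upper triangular matrices.\<close>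

lemma coset_filI_mono:
  assumes f: "f \<in> classfun n"
    and *: "\<And>\<gamma> x. (\<And>i j. i \<le> j \<Longrightarrow> j < n \<Longrightarrow> \<gamma> i \<le> \<gamma> j) \<Longrightarrow> x \<in> color_parab n \<gamma> \<Longrightarrow>
      k < card (\<gamma> ` {..<n}) \<Longrightarrow> (\<Sum>y \<in> color_coset n \<gamma> x. f y) = 0"
  shows "f \<in> coset_fil n k"
proof -
  have "(\<Sum>y \<in> color_coset n \<beta> x. f y) = 0" if x: "x \<in> color_parab n \<beta>" and k: "k < card (\<beta> ` {..<n})" for \<beta> x
  proof -
    obtain \<sigma> where s: "bij_betw \<sigma> {..<n} {..<n}" and m: "\<And>i j. i \<le> j \<Longrightarrow> j < n \<Longrightarrow> \<beta> (\<sigma> i) \<le> \<beta> (\<sigma> j)"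
      using sort_colors[of n \<beta>] by blast
    have sl: "\<sigma> i < n" if "i < n" for i using bij_betwE[OF s] that by auto
    have "(\<Sum>y \<in> color_coset n \<beta> x. f y) = (\<Sum>y \<in> color_coset n \<beta> x. f (permute_mat n \<sigma> y))"
    proof (rule sum.cong[OF refl])
      fix y assume "y \<in> color_coset n \<beta> x"
      then have y: "y \<in> carrier_mat n n" by (rule entry_coset_carrier)
      show "f y = f (permute_mat n \<sigma> y)"
        using classfun_conjm[OF f perm_mat_GLn[OF s] y] conjm_perm_mat[OF s y] by simp
    qed
    also have "\<dots> = (\<Sum>y \<in> color_coset n (\<beta> \<circ> \<sigma>) (permute_mat n \<sigma> x). f y)"
      by (rule sum_permute_color_coset[OF s])
    also have "\<dots> = 0"
    proof (rule *)
      show "permute_mat n \<sigma> x \<in> color_parab n (\<beta> \<circ> \<sigma>)" by (rule permute_color_parab[OF sl x])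
      have "(\<beta> \<circ> \<sigma>) ` {..<n} = \<beta> ` {..<n}" unfolding image_comp[symmetric] bij_betw_imp_surj_on[OF s] ..
      then show "k < card ((\<beta> \<circ> \<sigma>) ` {..<n})" using k by simp
    qed (use m in simp)
    finally show ?thesis .
  qed
  then show ?thesis using f unfolding coset_fil_def by blast
qed

lemma color_coset_parab:
  assumes "x \<in> color_parab n \<beta>" "y \<in> color_coset n \<beta> x"
  shows "y \<in> color_parab n \<beta>"
  using assms by (auto simp: entry_coset_def color_parab_def)

lemma color_parab_mono_colors:
  assumes "\<And>i j. i \<le> j \<Longrightarrow> j < n \<Longrightarrow> \<gamma> i \<le> (\<gamma> j :: nat)"
  shows "color_parab n (\<lambda>i. i) \<subseteq> color_parab n \<gamma>"
proof
  fix x :: "'a mat" assume x: "x \<in> color_parab n (\<lambda>i. i)"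
  have "x $$ (i,j) = 0" if "i < n" "j < n" "\<gamma> j < \<gamma> i" for i j
  proof -
    have "j < i" using assms[of i j] that by (meson leD not_le_imp_less)
    then show ?thesis using x that by (simp add: color_parab_def)
  qed
  then show "x \<in> color_parab n \<gamma>" using x by (simp add: color_parab_def)
qed

section \<open>Coset sums of an inflated product\<close>

lemma bij_ul_block_coset:
  fixes y :: "'a::{finite,field} mat"
  assumes "y \<in> carrier_mat (n1+n2) (n1+n2)"
  shows "bij_betw (ul_block n1) (entry_coset (n1+n2) {(i,j). i < n1 \<and> j < n1 \<and> \<gamma> i < \<gamma> j} y)
    (color_coset n1 \<gamma> (ul_block n1 y))"
proof (rule bij_betw_byWitness[of _ "\<lambda>z. mat (n1+n2) (n1+n2) (\<lambda>(i,j). if i < n1 \<and> j < n1 then z $$ (i,j) else y $$ (i,j))"])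
qed (auto simp: entry_coset_def ul_block_def intro!: eq_matI)

lemma bij_lr_block_coset:
  fixes y :: "'a::{finite,field} mat"
  assumes "y \<in> carrier_mat (n1+n2) (n1+n2)"
  shows "bij_betw (lr_block n1 n2) (entry_coset (n1+n2) {(i,j). n1 \<le> i \<and> n1 \<le> j \<and> \<gamma> i < \<gamma> j} y)
    (color_coset n2 (\<lambda>i. \<gamma> (i + n1)) (lr_block n1 n2 y))"
proof (rule bij_betw_byWitness[of _ "\<lambda>z. mat (n1+n2) (n1+n2) (\<lambda>(i,j). if n1 \<le> i \<and> n1 \<le> j then z $$ (i - n1,j - n1) else y $$ (i,j))"])
qed (auto simp: entry_coset_def lr_block_def intro!: eq_matI)

lemma block_color_parab:
  assumes "y \<in> color_parab (n1+n2) \<gamma>"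
  shows "ul_block n1 y \<in> color_parab n1 \<gamma>" "lr_block n1 n2 y \<in> color_parab n2 (\<lambda>i. \<gamma> (i + n1))"
  using assms by (auto simp: color_parab_def ul_block_def lr_block_def)

lemma entry_coset_two_block_parab:
  assumes "y' \<in> entry_coset (n1+n2) N y" "y \<in> carrier_mat (n1+n2) (n1+n2)" "\<And>i j. n1 \<le> i \<Longrightarrow> j < n1 \<Longrightarrow> (i,j) \<notin> N"
  shows "y' \<in> color_parab (n1+n2) (two_block n1) \<longleftrightarrow> y \<in> color_parab (n1+n2) (two_block n1)"
proof -
  have "y' $$ (i,j) = y $$ (i,j)" if "i < n1+n2" "j < n1+n2" "two_block n1 j < two_block n1 i" for i j
    using assms that by (auto simp: entry_coset_def two_block_def split: if_splits)
  then show ?thesis using assms(2) entry_coset_carrier[OF assms(1)] unfolding color_parab_def by auto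
qed

text \<open>The case of coordinate position. The colours used split over the first \<open>n1\<close>
  and the last \<open>n2\<close> indices, so one of the two parts sees more than \<open>k\<close> or
  more than \<open>l\<close> colours. Freeing only positions inside that diagonal block fixes the
  other block and membership in the two-block parabolic, so the sum is a constant times a vanishing
  coset sum of \<open>f1\<close> or \<open>f2\<close>. Here \<open>\<gamma>\<close> is not assumed
  monotone, since it arrives permuted.\<close>

lemma sum_parab_ext_eq_0:
  fixes x :: "'a::{finite,field} mat"
  assumes f1: "f1 \<in> coset_fil n1 k" and f2: "f2 \<in> coset_fil n2 l"
    and x: "x \<in> color_parab (n1+n2) \<gamma>" and kl: "k + l < card (\<gamma> ` {..<n1+n2})"
  shows "(\<Sum>y \<in> color_coset (n1+n2) \<gamma> x. parab_ext n1 n2 f1 f2 y) = 0"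
proof -
  let ?n = "n1 + n2" and ?P = "color_parab (n1+n2) (two_block n1) :: 'a mat set"
  let ?\<gamma>2 = "\<lambda>i. \<gamma> (i + n1)"
  have "i \<in> {..<n1} \<union> (\<lambda>i. i + n1) ` {..<n2}" if "i < n1 + n2" for i
    using that image_eqI[of i "\<lambda>i. i + n1" "i - n1" "{..<n2}"] by (cases "i < n1") auto
  then have "{..<n1+n2} = {..<n1} \<union> (\<lambda>i. i + n1) ` {..<n2}" by auto
  then have "\<gamma> ` {..<n1+n2} = \<gamma> ` {..<n1} \<union> ?\<gamma>2 ` {..<n2}" by (simp add: image_Un image_image)
  then have "card (\<gamma> ` {..<n1+n2}) \<le> card (\<gamma> ` {..<n1}) + card (?\<gamma>2 ` {..<n2})" by (simp add: card_Un_le)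
  with kl consider (1) "k < card (\<gamma> ` {..<n1})" | (2) "l < card (?\<gamma>2 ` {..<n2})" by linarith
  then show ?thesis
  proof cases
    case 1
    let ?N = "{(i,j). i < n1 \<and> j < n1 \<and> \<gamma> i < \<gamma> j}"
    show ?thesis
    proof (rule sum_entry_coset_eq_0[of ?N])
      fix y assume "y \<in> color_coset ?n \<gamma> x"
      then have yP: "y \<in> color_parab ?n \<gamma>" by (rule color_coset_parab[OF x])
      note yc = color_parab_carrier[OF yP]
      have iff: "y' \<in> ?P \<longleftrightarrow> y \<in> ?P" if "y' \<in> entry_coset ?n ?N y" for y'
        by (rule entry_coset_two_block_parab[OF that yc]) auto
      show "(\<Sum>y' \<in> entry_coset ?n ?N y. parab_ext n1 n2 f1 f2 y') = 0"
      proof (cases "y \<in> ?P")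
        case True
        have "lr_block n1 n2 y' = lr_block n1 n2 y" if "y' \<in> entry_coset ?n ?N y" for y'
          using that unfolding lr_block_def by (intro eq_matI) (auto simp: entry_coset_def)
        then have "(\<Sum>y' \<in> entry_coset ?n ?N y. parab_ext n1 n2 f1 f2 y') =
            (\<Sum>y' \<in> entry_coset ?n ?N y. f1 (ul_block n1 y') * f2 (lr_block n1 n2 y))"
          using iff True by (intro sum.cong) (auto simp: parab_ext_def)
        also have "\<dots> = (\<Sum>z \<in> color_coset n1 \<gamma> (ul_block n1 y). f1 z * f2 (lr_block n1 n2 y))"
          by (rule sum.reindex_bij_betw[OF bij_ul_block_coset[OF yc], of "\<lambda>z. f1 z * f2 (lr_block n1 n2 y)"])
        also have "\<dots> = 0"
          using f1 block_color_parab(1)[OF yP] 1 by (simp add: sum_distrib_right[symmetric] coset_fil_def)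
        finally show ?thesis .
      qed (use iff in \<open>auto simp: parab_ext_def intro!: sum.neutral\<close>)
    qed auto
  next
    case 2
    let ?N = "{(i,j). n1 \<le> i \<and> n1 \<le> j \<and> \<gamma> i < \<gamma> j}"
    show ?thesis
    proof (rule sum_entry_coset_eq_0[of ?N])
      fix y assume "y \<in> color_coset ?n \<gamma> x"
      then have yP: "y \<in> color_parab ?n \<gamma>" by (rule color_coset_parab[OF x])
      note yc = color_parab_carrier[OF yP]
      have iff: "y' \<in> ?P \<longleftrightarrow> y \<in> ?P" if "y' \<in> entry_coset ?n ?N y" for y'
        by (rule entry_coset_two_block_parab[OF that yc]) auto
      show "(\<Sum>y' \<in> entry_coset ?n ?N y. parab_ext n1 n2 f1 f2 y') = 0"
      proof (cases "y \<in> ?P")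
        case True
        have "ul_block n1 y' = ul_block n1 y" if "y' \<in> entry_coset ?n ?N y" for y'
          using that unfolding ul_block_def by (intro eq_matI) (auto simp: entry_coset_def)
        then have "(\<Sum>y' \<in> entry_coset ?n ?N y. parab_ext n1 n2 f1 f2 y') =
            (\<Sum>y' \<in> entry_coset ?n ?N y. f1 (ul_block n1 y) * f2 (lr_block n1 n2 y'))"
          using iff True by (intro sum.cong) (auto simp: parab_ext_def)
        also have "\<dots> = (\<Sum>z \<in> color_coset n2 ?\<gamma>2 (lr_block n1 n2 y). f1 (ul_block n1 y) * f2 z)"
          by (rule sum.reindex_bij_betw[OF bij_lr_block_coset[OF yc], of "\<lambda>z. f1 (ul_block n1 y) * f2 z"])
        also have "\<dots> = 0"
          using f2 block_color_parab(2)[OF yP] 2 by (simp add: sum_distrib_left[symmetric] coset_fil_def)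
        finally show ?thesis .
      qed (use iff in \<open>auto simp: parab_ext_def intro!: sum.neutral\<close>)
    qed auto
  qed
qed

lemma parab_ext_conjm:
  assumes "f1 \<in> classfun n1" "f2 \<in> classfun n2" "p \<in> GLn (n1+n2)" "p \<in> color_parab (n1+n2) (two_block n1)"
    "y \<in> carrier_mat (n1+n2) (n1+n2)"
  shows "parab_ext n1 n2 f1 f2 (conjm p y) = parab_ext n1 n2 f1 f2 y"
  using conjm_parab_iff[OF assms(3-5)] block_conjm[OF assms(3,4)] block_GLn[OF assms(3,4)]
    classfun_conjm[OF assms(1)] classfun_conjm[OF assms(2)]
  by (simp add: parab_ext_def)

text \<open>Bruhat reduces \<open>g\<close> to a permutation. The left factor \<open>p\<close> lies
  in the two-block parabolic and does not change the inflation; the right factor \<open>b\<close>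
  lies in the parabolic of the monotone colouring \<open>\<gamma>\<close> and only moves the coset
  of \<open>x'\<close> to that of \<open>x\<close>. What is left permutes coordinates and replaces
  \<open>\<gamma>\<close> by \<open>\<gamma> \<circ> \<tau>\<close>, with the same number of
  colours.\<close>

lemma sum_parab_ext_conjm_eq_0:
  fixes x :: "'a::{finite,field} mat"
  assumes f1: "f1 \<in> coset_fil n1 k" and f2: "f2 \<in> coset_fil n2 l"
    and x: "x \<in> color_parab (n1+n2) \<gamma>" and kl: "k + l < card (\<gamma> ` {..<n1+n2})"
    and mono: "\<And>i j. i \<le> j \<Longrightarrow> j < n1+n2 \<Longrightarrow> \<gamma> i \<le> \<gamma> j" and g: "g \<in> GLn (n1+n2)"
  shows "(\<Sum>y \<in> color_coset (n1+n2) \<gamma> x. parab_ext n1 n2 f1 f2 (conjm g y)) = 0"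
proof -
  let ?n = "n1 + n2" and ?F = "parab_ext n1 n2 f1 f2"
  obtain p b \<tau> where p: "p \<in> GLn ?n" "p \<in> color_parab ?n (\<lambda>i. i)" and b: "b \<in> GLn ?n" "b \<in> color_parab ?n (\<lambda>i. i)"
    and t: "bij_betw \<tau> {..<?n} {..<?n}" and pgb: "p * g * b = perm_mat ?n \<tau>"
    by (rule bruhat[OF g])
  have "color_parab ?n (\<lambda>i. i) \<subseteq> (color_parab ?n (two_block n1) :: 'a mat set)"
    by (rule color_parab_mono_colors) (auto simp: two_block_def)
  with p have pP: "p \<in> color_parab ?n (two_block n1)" by blast
  have bP: "b \<in> color_parab ?n \<gamma>" by (rule subsetD[OF color_parab_mono_colors b(2)]) (rule mono)
  have fc: "f1 \<in> classfun n1" "f2 \<in> classfun n2" using f1 f2 by (simp_all add: coset_fil_def)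
  define x' where "x' = conjm (minv b) x"
  have x': "x' \<in> color_parab ?n \<gamma>"
    unfolding x'_def by (rule conjm_color_parab[OF minv_color_parab[OF bP b(1)] minv_GLn[OF b(1)] x])
  note x'c = color_parab_carrier[OF x']
  have bx: "conjm b x' = x" unfolding x'_def by (rule conjm_minv(2)[OF b(1) color_parab_carrier[OF x]])
  have tl: "\<tau> i < ?n" if "i < ?n" for i using bij_betwE[OF t] that by auto
  have "(\<Sum>y \<in> color_coset ?n \<gamma> x. ?F (conjm g y)) = (\<Sum>y \<in> color_coset ?n \<gamma> x'. ?F (conjm g (conjm b y)))"
    using sum.reindex_bij_betw[OF bij_conjm_color_coset[OF bP b(1) x'c], of "\<lambda>y. ?F (conjm g y)"] bx by simp
  also have "\<dots> = (\<Sum>y \<in> color_coset ?n \<gamma> x'. ?F (permute_mat ?n \<tau> y))"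
  proof (rule sum.cong[OF refl])
    fix y assume "y \<in> color_coset ?n \<gamma> x'"
    then have y: "y \<in> carrier_mat ?n ?n" by (rule entry_coset_carrier)
    have "?F (conjm g (conjm b y)) = ?F (conjm p (conjm g (conjm b y)))"
      using parab_ext_conjm[OF fc p(1) pP] g b(1) y by simp
    also have "conjm p (conjm g (conjm b y)) = conjm (p * g * b) y"
      using conjm_mult[OF mult_GLn[OF p(1) g] b(1) y] conjm_mult[OF p(1) g, of "conjm b y"] b(1) y by simp
    also have "\<dots> = permute_mat ?n \<tau> y" unfolding pgb by (rule conjm_perm_mat[OF t y])
    finally show "?F (conjm g (conjm b y)) = ?F (permute_mat ?n \<tau> y)" .
  qed
  also have "\<dots> = (\<Sum>y \<in> color_coset ?n (\<gamma> \<circ> \<tau>) (permute_mat ?n \<tau> x'). ?F y)"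
    by (rule sum_permute_color_coset[OF t])
  also have "\<dots> = 0"
  proof (rule sum_parab_ext_eq_0[OF f1 f2])
    show "permute_mat ?n \<tau> x' \<in> color_parab ?n (\<gamma> \<circ> \<tau>)" by (rule permute_color_parab[OF tl x'])
    have "(\<gamma> \<circ> \<tau>) ` {..<?n} = \<gamma> ` {..<?n}" unfolding image_comp[symmetric] bij_betw_imp_surj_on[OF t] ..
    then show "k + l < card ((\<gamma> \<circ> \<tau>) ` {..<?n})" using kl by simp
  qed
  finally show ?thesis .
qed

lemma coset_fil_scale: "f \<in> coset_fil n k \<Longrightarrow> (\<lambda>x. c * f x) \<in> coset_fil n k"
  by (auto simp: coset_fil_def sum_distrib_left[symmetric] intro: classfun_scale)

lemma coset_fil_add: "f \<in> coset_fil n k \<Longrightarrow> h \<in> coset_fil n k \<Longrightarrow> (\<lambda>x. f x + h x) \<in> coset_fil n k"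
  by (auto simp: coset_fil_def sum.distrib intro: classfun_add)

lemma HC_ind_coset_fil:
  assumes f1: "f1 \<in> coset_fil n1 k" and f2: "f2 \<in> coset_fil n2 l"
  shows "HC_ind n1 n2 (ext_prod n1 n2 f1 f2) \<in> coset_fil (n1+n2) (k+l)"
  unfolding HC_ind_eq
proof (intro coset_fil_scale coset_filI_mono class_avg_classfun)
  fix \<gamma> and x :: "'a mat"
  assume mono: "\<And>i j. i \<le> j \<Longrightarrow> j < n1+n2 \<Longrightarrow> \<gamma> i \<le> \<gamma> j" and x: "x \<in> color_parab (n1+n2) \<gamma>"
    and kl: "k + l < card (\<gamma> ` {..<n1+n2})"
  have "(\<Sum>y \<in> color_coset (n1+n2) \<gamma> x. class_avg (n1+n2) (parab_ext n1 n2 f1 f2) y) =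
      (\<Sum>y \<in> color_coset (n1+n2) \<gamma> x. \<Sum>g\<in>GLn (n1+n2). parab_ext n1 n2 f1 f2 (conjm g y))"
    by (intro sum.cong) (auto simp: class_avg_def dest: entry_coset_carrier)
  also have "\<dots> = (\<Sum>g\<in>GLn (n1+n2). \<Sum>y \<in> color_coset (n1+n2) \<gamma> x. parab_ext n1 n2 f1 f2 (conjm g y))"
    by (rule sum.swap)
  also have "\<dots> = 0"
    using sum_parab_ext_conjm_eq_0[OF f1 f2 x kl mono] by (intro sum.neutral) auto
  finally show "(\<Sum>y \<in> color_coset (n1+n2) \<gamma> x. class_avg (n1+n2) (parab_ext n1 n2 f1 f2) y) = 0" .
qed

subsection \<open>Spans and orthogonal projection\<close>

text \<open>Adding one scaled generator at a time turns linear extension from generators into rule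
  induction.\<close>

inductive_set fun_span :: "('b \<Rightarrow> complex) set \<Rightarrow> ('b \<Rightarrow> complex) set" for B where
  fun_span_zero: "(\<lambda>_. 0) \<in> fun_span B"
| fun_span_step: "b \<in> B \<Longrightarrow> w \<in> fun_span B \<Longrightarrow> (\<lambda>x. c * b x + w x) \<in> fun_span B"

lemma fun_span_base: "b \<in> B \<Longrightarrow> b \<in> fun_span B"
  using fun_span_step[OF _ fun_span_zero, of b B 1] by simp

lemma fun_span_lin:
  assumes "w \<in> fun_span B" "v \<in> fun_span B"
  shows "(\<lambda>x. c * w x + v x) \<in> fun_span B"
  using assms(1)
proof induction
  case (fun_span_step b w d)
  from fun_span.fun_span_step[OF this(1,3), of "c * d"] show ?case
    by (simp add: algebra_simps)
qed (use assms(2) in simp)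

lemma fun_span_scale: "w \<in> fun_span B \<Longrightarrow> (\<lambda>x. c * w x) \<in> fun_span B"
  using fun_span_lin[OF _ fun_span_zero, of w B c] by simp

lemma fun_span_add: "w \<in> fun_span B \<Longrightarrow> v \<in> fun_span B \<Longrightarrow> (\<lambda>x. w x + v x) \<in> fun_span B"
  using fun_span_lin[of w B v 1] by simp

lemma fun_span_diff: "w \<in> fun_span B \<Longrightarrow> v \<in> fun_span B \<Longrightarrow> (\<lambda>x. w x - v x) \<in> fun_span B"
  using fun_span_lin[of v B w "-1"] by simp

lemma fun_span_sum:
  "finite K \<Longrightarrow> (\<And>k. k \<in> K \<Longrightarrow> a k \<in> fun_span B) \<Longrightarrow> (\<lambda>x. \<Sum>k\<in>K. a k x) \<in> fun_span B"
  by (induction K rule: finite_induct) (simp_all add: fun_span_zero fun_span_add)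

lemma fun_span_mono: "B \<subseteq> C \<Longrightarrow> fun_span B \<subseteq> fun_span C"
proof
  fix w assume "B \<subseteq> C" "w \<in> fun_span B"
  from this(2,1) show "w \<in> fun_span C"
    by induction (auto intro: fun_span.intros)
qed

lemma fun_span_classfun:
  assumes "B \<subseteq> classfun n" "w \<in> fun_span B" shows "w \<in> classfun n"
  using assms(2) by induction (use assms(1) in \<open>auto intro: classfun_lin classfun_zero\<close>)

definition mat_ip :: "nat \<Rightarrow> ('a::{finite,field} mat \<Rightarrow> complex) \<Rightarrow> ('a mat \<Rightarrow> complex) \<Rightarrow> complex" where
  "mat_ip n f h = (\<Sum>x\<in>carrier_mat n n. f x * cnj (h x))"

lemma mat_ip_lin: "mat_ip n (\<lambda>x. c * f x + h x) g = c * mat_ip n f g + mat_ip n h g"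
  by (simp add: mat_ip_def sum.distrib sum_distrib_left algebra_simps)

lemma mat_ip_sum: "mat_ip n (\<lambda>x. \<Sum>k\<in>K. a k x) g = (\<Sum>k\<in>K. mat_ip n (a k) g)"
  unfolding mat_ip_def sum_distrib_right by (rule sum.swap)

lemma mat_ip_cnj: "mat_ip n f h = cnj (mat_ip n h f)"
  by (simp add: mat_ip_def mult.commute)

lemma mat_ip_span:
  assumes "\<And>b. b \<in> B \<Longrightarrow> mat_ip n f b = 0" "w \<in> fun_span B"
  shows "mat_ip n f w = 0"
  using assms(2)
proof induction
  case (fun_span_step b w c)
  have "mat_ip n (\<lambda>x. c * b x + w x) f = 0"
    unfolding mat_ip_lin using assms(1)[OF fun_span_step(1)] fun_span_step(3)
    by (metis mat_ip_cnj complex_cnj_zero add_0 mult_zero_right)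
  then show ?case by (metis mat_ip_cnj complex_cnj_zero)
qed (simp add: mat_ip_def)

lemma mat_ip_self_eq_0:
  assumes "mat_ip n f f = 0" "x \<in> carrier_mat n n"
  shows "f x = 0"
proof -
  have "mat_ip n f f = of_real (\<Sum>x\<in>carrier_mat n n. (cmod (f x))\<^sup>2)"
    unfolding mat_ip_def by (simp add: complex_norm_square del: of_real_power)
  then have "complex_of_real (\<Sum>x\<in>carrier_mat n n. (cmod (f x))\<^sup>2) = 0" using assms(1) by simp
  then have "(\<Sum>x\<in>carrier_mat n n. (cmod (f x))\<^sup>2) = 0" by (simp only: of_real_eq_0_iff)
  then have "(cmod (f x))\<^sup>2 = 0" using assms(2) by (subst (asm) sum_nonneg_eq_0_iff) auto
  then show ?thesis by simp
qed

text \<open>Gram-Schmidt, one generator at a time. The function \<open>f\<close> stays arbitrary in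
  the induction because the hypothesis is applied both to \<open>f\<close> and to the new generator
  \<open>b\<close>.\<close>

lemma orthogonal_projection:
  assumes "finite B"
  shows "\<exists>w \<in> fun_span B. \<forall>b\<in>B. mat_ip n (\<lambda>x. f x - w x) b = 0"
  using assms
proof (induction B arbitrary: f rule: finite_induct)
  case empty
  show ?case using fun_span_zero by blast
next
  case (insert b B)
  obtain v where v: "v \<in> fun_span B" "\<forall>c\<in>B. mat_ip n (\<lambda>x. b x - v x) c = 0" using insert.IH by blast
  obtain w where w: "w \<in> fun_span B" "\<forall>c\<in>B. mat_ip n (\<lambda>x. f x - w x) c = 0" using insert.IH by blast
  define r where "r = (\<lambda>x. b x - v x)"
  define s where "s = (\<lambda>x. f x - w x)"
  define t where "t = mat_ip n s r / mat_ip n r r"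
  define w' where "w' = (\<lambda>x. t * r x + w x)"
  have vw: "v \<in> fun_span (insert b B)" "w \<in> fun_span (insert b B)" "b \<in> fun_span (insert b B)"
    using v w fun_span_mono[of B "insert b B"] fun_span_base[of b "insert b B"] by blast+
  have "w' \<in> fun_span (insert b B)" unfolding w'_def r_def by (intro fun_span_lin fun_span_diff vw)
  moreover have eq: "(\<lambda>x. f x - w' x) = (\<lambda>x. (- t) * r x + s x)" by (simp add: w'_def s_def fun_eq_iff)
  have B: "mat_ip n (\<lambda>x. f x - w' x) c = 0" if "c \<in> B" for c
    unfolding eq mat_ip_lin using v(2) w(2) that by (simp add: r_def s_def)
  \<comment> \<open>If \<open>r\<close> has norm zero, it vanishes on all matrices of the right size
    and every inner product with it is zero; otherwise \<open>t\<close> is the usual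
    coefficient.\<close>
  have R: "mat_ip n (\<lambda>x. f x - w' x) r = 0"
  proof (cases "mat_ip n r r = 0")
    case True
    have "mat_ip n h r = 0" for h
      unfolding mat_ip_def by (intro sum.neutral ballI) (simp add: mat_ip_self_eq_0[OF True])
    then show ?thesis .
  next
    case False
    then show ?thesis unfolding eq mat_ip_lin by (simp add: t_def)
  qed
  have "mat_ip n (\<lambda>x. f x - w' x) v = 0" by (rule mat_ip_span[OF B v(1)])
  with R have "mat_ip n (\<lambda>x. f x - w' x) (\<lambda>x. 1 * r x + v x) = 0"
    by (subst mat_ip_cnj) (simp only: mat_ip_lin mat_ip_cnj[of n r] mat_ip_cnj[of n v], simp)
  then have "mat_ip n (\<lambda>x. f x - w' x) b = 0" by (simp add: r_def)
  ultimately show ?case using B by blast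
qed

subsection \<open>Generators\<close>

lemma coset_avg_classfun: "coset_avg n \<beta> x \<in> classfun n"
  unfolding coset_avg_def by (rule class_avg_classfun)

lemma coset_gens_classfun: "coset_gens n k \<subseteq> classfun n"
  using coset_avg_classfun by (auto simp: coset_gens_def)

text \<open>There are infinitely many colourings, but an average depends only on its coset, a subset
  of a finite set. Projection onto the span of the generators requires this finiteness.\<close>

lemma finite_coset_avgs:
  assumes "S \<subseteq> {coset_avg n \<beta> x | \<beta> x. True}"
  shows "finite (S :: ('a::{finite,field} mat \<Rightarrow> complex) set)"
proof (rule finite_subset)
  show "S \<subseteq> (\<lambda>A. class_avg n (\<lambda>y. of_bool (y \<in> A))) ` Pow (carrier_mat n n)"
  proof
    fix b assume "b \<in> S"
    then obtain \<beta> and x :: "'a mat" where b: "b = coset_avg n \<beta> x" using assms by blast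
    show "b \<in> (\<lambda>A. class_avg n (\<lambda>y. of_bool (y \<in> A))) ` Pow (carrier_mat n n)"
      unfolding b coset_avg_def by (rule imageI) (auto dest: entry_coset_carrier)
  qed
qed simp

lemma finite_coset_gens: "finite (coset_gens n k)"
  by (rule finite_coset_avgs[of _ n]) (auto simp: coset_gens_def)

lemma coset_gens_antimono: "k \<le> l \<Longrightarrow> coset_gens n l \<subseteq> coset_gens n k"
  unfolding coset_gens_def by (blast intro: order_trans)

lemma card_colors_le: "card (\<beta> ` {..<n::nat}) \<le> n"
  using card_image_le[of "{..<n}" \<beta>] by simp

lemma coset_gens_empty:
  assumes "n < k" shows "coset_gens n k = {}"
proof -
  have "\<not> k \<le> card (\<beta> ` {..<n})" for \<beta> :: "nat \<Rightarrow> nat"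
    using card_colors_le[of \<beta> n] assms by linarith
  then show ?thesis unfolding coset_gens_def by blast
qed

text \<open>The reciprocity behind the grading: it turns vanishing coset sums into orthogonality,
  making \<open>coset_fil n k\<close> the orthogonal complement of
  \<open>coset_gens n (Suc k)\<close> within the class functions.\<close>

lemma mat_ip_coset_avg:
  assumes "f \<in> classfun n"
  shows "mat_ip n f (coset_avg n \<beta> x) =
    of_nat (card (GLn n :: 'a::{finite,field} mat set)) * (\<Sum>y\<in>color_coset n \<beta> (x :: 'a mat). f y)"
proof -
  have "(\<Sum>y\<in>carrier_mat n n. f y * cnj (of_bool (y \<in> color_coset n \<beta> x))) = (\<Sum>y\<in>color_coset n \<beta> x. f y)"
    by (rule sum.mono_neutral_cong_right) (auto dest: entry_coset_carrier)
  then show ?thesis unfolding mat_ip_def coset_avg_def sum_classfun_avg[OF assms] by simp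
qed

lemma mat_ip_coset_avg_eq_0:
  assumes "f \<in> classfun n"
  shows "mat_ip n f (coset_avg n \<beta> x) = 0 \<longleftrightarrow> (\<Sum>y\<in>color_coset n \<beta> x. f y) = 0"
  by (simp add: mat_ip_coset_avg[OF assms])

lemma coset_fil_iff:
  "f \<in> coset_fil n k \<longleftrightarrow> f \<in> classfun n \<and> (\<forall>b \<in> coset_gens n (Suc k). mat_ip n f b = 0)"
proof (cases "f \<in> classfun n")
  case True
  have "(\<forall>b \<in> coset_gens n (Suc k). mat_ip n f b = 0) \<longleftrightarrow>
      (\<forall>\<beta> x. x \<in> color_parab n \<beta> \<and> k < card (\<beta> ` {..<n}) \<longrightarrow> mat_ip n f (coset_avg n \<beta> x) = 0)"
    unfolding coset_gens_def Suc_le_eq by blast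
  then show ?thesis using True unfolding coset_fil_def mat_ip_coset_avg_eq_0[OF True] by blast
qed (simp add: coset_fil_def)

text \<open>The averages of single points already span the class functions, and a point is a coset
  for the constant colouring. That colouring uses one colour if \<open>n\<close> is positive and
  none if \<open>n = 0\<close>, which is what the two bounds on \<open>k\<close> encode.\<close>

lemma classfun_in_span:
  assumes f: "f \<in> classfun n" and k: "k \<le> 1" "k \<le> n"
  shows "(f :: 'a::{finite,field} mat \<Rightarrow> complex) \<in> fun_span (coset_gens n k)"
proof -
  let ?N = "of_nat (card (GLn n :: 'a mat set)) :: complex"
  have N: "?N \<noteq> 0" by simp
  have card: "k \<le> card ((\<lambda>_. 0 :: nat) ` {..<n})" using k by (cases n) (auto simp: image_constant_conv)
  have "f = (\<lambda>z. \<Sum>x\<in>carrier_mat n n. f x / ?N * coset_avg n (\<lambda>_. 0) x z)"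
  proof
    fix z :: "'a mat"
    show "f z = (\<Sum>x\<in>carrier_mat n n. f x / ?N * coset_avg n (\<lambda>_. 0) x z)"
    proof (cases "z \<in> carrier_mat n n")
      case True
      \<comment> \<open>With a single colour no position is free, so the coset is \<open>{x}\<close>
        and the average counts the \<open>g\<close> that carry \<open>z\<close> to
        \<open>x\<close>.\<close>
      have avg: "coset_avg n (\<lambda>_. 0) x z = (\<Sum>g\<in>GLn n. of_bool (conjm g z = x))" if "x \<in> carrier_mat n n" for x
      proof -
        have "y \<in> color_coset n (\<lambda>_. 0) x \<longleftrightarrow> y = x" if "y \<in> carrier_mat n n" for y
          using that \<open>x \<in> _\<close> by (auto simp: entry_coset_def intro!: eq_matI)
        then show ?thesis using True by (simp add: coset_avg_def class_avg_def)
      qed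
      have "(\<Sum>x\<in>carrier_mat n n. f x / ?N * coset_avg n (\<lambda>_. 0) x z) =
          (\<Sum>x\<in>carrier_mat n n. \<Sum>g\<in>GLn n. f x / ?N * of_bool (conjm g z = x))"
        by (intro sum.cong refl) (simp only: avg sum_distrib_left)
      also have "\<dots> = (\<Sum>g\<in>GLn n. \<Sum>x\<in>carrier_mat n n. f x / ?N * of_bool (conjm g z = x))"
        by (rule sum.swap)
      also have "\<dots> = (\<Sum>g\<in>(GLn n :: 'a mat set). f z / ?N)"
      proof (rule sum.cong[OF refl])
        fix g :: "'a mat" assume g: "g \<in> GLn n"
        have "(\<Sum>x\<in>carrier_mat n n. f x / ?N * of_bool (conjm g z = x)) = (\<Sum>x\<in>carrier_mat n n. if x = conjm g z then f x / ?N else 0)"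
          by (intro sum.cong) auto
        then show "(\<Sum>x\<in>carrier_mat n n. f x / ?N * of_bool (conjm g z = x)) = f z / ?N"
          using g True classfun_conjm[OF f g True] by simp
      qed
      finally show ?thesis using N by simp
    qed (use classfun_outside[OF f] in \<open>simp add: coset_avg_def class_avg_def\<close>)
  qed
  also have "\<dots> \<in> fun_span (coset_gens n k)"
  proof (intro fun_span_sum fun_span_scale fun_span_base)
    fix x :: "'a mat" assume "x \<in> carrier_mat n n"
    then have "x \<in> color_parab n (\<lambda>_. 0)" by (simp add: color_parab_def)
    then show "coset_avg n (\<lambda>_. 0) x \<in> coset_gens n k" using card unfolding coset_gens_def by blast
  qed simp
  finally show ?thesis .
qed

text \<open>Shifting the second colouring above the first makes every upper right position free and
  no lower left one, so the big coset consists of the matrices in the parabolic whose diagonal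
  blocks lie in the two small cosets. The constant is |GL_n1| |GL_n2| / |P|; that it is nonzero lets
  uniqueness recover the average from the induced function, and for that purpose \<open>x\<close>
  need not be block diagonal.\<close>

lemma HC_ind_coset_avg:
  fixes x :: "'a::{finite,field} mat"
  assumes x: "x \<in> color_parab (n1+n2) (two_block n1)" and m: "\<And>i. i < n1 \<Longrightarrow> \<beta>1 i < m"
  shows "\<exists>c. c \<noteq> 0 \<and>
    HC_ind n1 n2 (ext_prod n1 n2 (coset_avg n1 \<beta>1 (ul_block n1 x)) (coset_avg n2 \<beta>2 (lr_block n1 n2 x))) =
     (\<lambda>z. c * coset_avg (n1+n2) (\<lambda>i. if i < n1 then \<beta>1 i else \<beta>2 (i - n1) + m) x z)"
proof -
  let ?\<beta> = "\<lambda>i. if i < n1 then \<beta>1 i else \<beta>2 (i - n1) + m"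
  let ?n = "n1 + n2" and ?P = "color_parab (n1+n2) (two_block n1) :: 'a mat set"
  let ?c = "of_nat (card (GLn n1 :: 'a mat set)) * of_nat (card (GLn n2 :: 'a mat set)) /
     of_nat (card (parab_grp [n1,n2] :: 'a mat set)) :: complex"
  note xc = color_parab_carrier[OF x]
  have c: "?c \<noteq> 0"
    using parab_grp_card_pos[of n1 n2, where 'a='a] by simp
  have iff: "y \<in> ?P \<and> ul_block n1 y \<in> color_coset n1 \<beta>1 (ul_block n1 x) \<and> lr_block n1 n2 y \<in> color_coset n2 \<beta>2 (lr_block n1 n2 x)
     \<longleftrightarrow> y \<in> color_coset ?n ?\<beta> x" if y: "y \<in> carrier_mat ?n ?n" for y
  proof
    assume L: "y \<in> ?P \<and> ul_block n1 y \<in> color_coset n1 \<beta>1 (ul_block n1 x) \<and> lr_block n1 n2 y \<in> color_coset n2 \<beta>2 (lr_block n1 n2 x)"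
    have "y $$ (i,j) = x $$ (i,j)" if ij: "i < ?n" "j < ?n" and nb: "\<not> ?\<beta> i < ?\<beta> j" for i j
    proof -
      consider "i < n1" "j < n1" | "i \<ge> n1" "j \<ge> n1" | "i \<ge> n1" "j < n1" | "i < n1" "j \<ge> n1" by linarith
      then show ?thesis
      proof cases
        case 1
        then have "ul_block n1 y $$ (i,j) = ul_block n1 x $$ (i,j)"
          using L nb by (simp add: entry_coset_def)
        then show ?thesis using 1 by (simp add: ul_block_def)
      next
        case 2
        then have "lr_block n1 n2 y $$ (i-n1,j-n1) = lr_block n1 n2 x $$ (i-n1,j-n1)"
          using L nb ij by (simp add: entry_coset_def)
        then show ?thesis using 2 ij by (simp add: lr_block_def)
      next
        case 3
        then show ?thesis using L x ij two_block_parab_0 by metis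
      next
        case 4
        then show ?thesis using nb m[of i] by simp
      qed
    qed
    then show "y \<in> color_coset ?n ?\<beta> x" using y by (simp add: entry_coset_def)
  next
    assume R: "y \<in> color_coset ?n ?\<beta> x"
    have E: "y $$ (i,j) = x $$ (i,j)" if "i < ?n" "j < ?n" "\<not> ?\<beta> i < ?\<beta> j" for i j
      using R that by (simp add: entry_coset_def)
    have "y \<in> ?P"
    proof -
      have "y $$ (i,j) = 0" if ij: "i < ?n" "j < ?n" "two_block n1 j < two_block n1 i" for i j
      proof -
        have ij': "j < n1" "n1 \<le> i" using ij by (auto simp: two_block_def split: if_splits)
        then have "\<not> ?\<beta> i < ?\<beta> j" using m[of j] by simp
        then show ?thesis using E[OF ij(1,2)] two_block_parab_0[OF x ij'(2) ij(1) ij'(1)] by simp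
      qed
      then show ?thesis using y by (simp add: color_parab_def)
    qed
    moreover have "ul_block n1 y \<in> color_coset n1 \<beta>1 (ul_block n1 x)"
      using E by (auto simp: entry_coset_def ul_block_def)
    moreover have "lr_block n1 n2 y \<in> color_coset n2 \<beta>2 (lr_block n1 n2 x)"
      using E by (auto simp: entry_coset_def lr_block_def)
    ultimately show "y \<in> ?P \<and> ul_block n1 y \<in> color_coset n1 \<beta>1 (ul_block n1 x) \<and> lr_block n1 n2 y \<in> color_coset n2 \<beta>2 (lr_block n1 n2 x)"
      by blast
  qed
  have pe: "parab_ext n1 n2 (\<lambda>y. of_bool (y \<in> color_coset n1 \<beta>1 (ul_block n1 x))) (\<lambda>y. of_bool (y \<in> color_coset n2 \<beta>2 (lr_block n1 n2 x))) y
      = of_bool (y \<in> color_coset ?n ?\<beta> x)" if "y \<in> carrier_mat ?n ?n" for y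
    unfolding iff[OF that, symmetric] parab_ext_def by simp
  have "class_avg ?n (parab_ext n1 n2 (\<lambda>y. of_bool (y \<in> color_coset n1 \<beta>1 (ul_block n1 x))) (\<lambda>y. of_bool (y \<in> color_coset n2 \<beta>2 (lr_block n1 n2 x))))
      = coset_avg ?n ?\<beta> x"
    unfolding coset_avg_def by (intro ext) (simp add: class_avg_def pe)
  then have "HC_ind n1 n2 (ext_prod n1 n2 (coset_avg n1 \<beta>1 (ul_block n1 x)) (coset_avg n2 \<beta>2 (lr_block n1 n2 x))) =
     (\<lambda>z. ?c * coset_avg ?n ?\<beta> x z)"
    unfolding coset_avg_def[of n1] coset_avg_def[of n2] HC_ind_class_avg by simp
  with c show ?thesis by blast
qed

lemma HC_ind_coset_gens:
  assumes "b1 \<in> coset_gens n1 k" "b2 \<in> coset_gens n2 l"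
  shows "HC_ind n1 n2 (ext_prod n1 n2 b1 b2) \<in> fun_span (coset_gens (n1+n2) (k+l))"
proof -
  obtain \<beta>1 x1 where 1: "b1 = coset_avg n1 \<beta>1 x1" "x1 \<in> color_parab n1 \<beta>1" "k \<le> card (\<beta>1 ` {..<n1})"
    using assms(1) by (auto simp: coset_gens_def)
  obtain \<beta>2 x2 where 2: "b2 = coset_avg n2 \<beta>2 x2" "x2 \<in> color_parab n2 \<beta>2" "l \<le> card (\<beta>2 ` {..<n2})"
    using assms(2) by (auto simp: coset_gens_def)
  \<comment> \<open>A strict upper bound for the colours in \<open>\<beta>1\<close> that also makes
    sense when \<open>n1 = 0\<close>.\<close>
  define m where "m = Suc (\<Sum>i<n1. \<beta>1 i)"
  have m: "\<beta>1 i < m" if "i < n1" for i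
    using member_le_sum[of i "{..<n1}" \<beta>1] that by (simp add: m_def less_Suc_eq_le)
  let ?x = "diag_block n1 n2 x1 x2" and ?\<beta> = "\<lambda>i. if i < n1 then \<beta>1 i else \<beta>2 (i - n1) + m"
  have x: "x1 \<in> carrier_mat n1 n1" "x2 \<in> carrier_mat n2 n2" using 1(2) 2(2) by (auto dest: color_parab_carrier)
  obtain c where "HC_ind n1 n2 (ext_prod n1 n2 (coset_avg n1 \<beta>1 (ul_block n1 ?x)) (coset_avg n2 \<beta>2 (lr_block n1 n2 ?x))) =
     (\<lambda>z. c * coset_avg (n1+n2) ?\<beta> ?x z)"
    using HC_ind_coset_avg[of ?x n1 n2 \<beta>1 m \<beta>2, OF diag_block_parab m] by blast
  then have eq: "HC_ind n1 n2 (ext_prod n1 n2 b1 b2) = (\<lambda>z. c * coset_avg (n1+n2) ?\<beta> ?x z)"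
    using 1(1) 2(1) x by simp
  have "?x \<in> color_parab (n1+n2) ?\<beta>"
  proof -
    have "?x $$ (i,j) = 0" if "i < n1+n2" "j < n1+n2" "?\<beta> j < ?\<beta> i" for i j
      using that 1(2) 2(2) by (auto simp: diag_block_def color_parab_def split: if_splits)
    then show ?thesis by (simp add: color_parab_def)
  qed
  moreover have "k + l \<le> card (?\<beta> ` {..<n1+n2})"
  proof -
    \<comment> \<open>Disjoint colour ranges make the block numbers add, which is the additivity of
      the lower bound on the degree.\<close>
    have "\<beta>1 ` {..<n1} \<inter> (\<lambda>i. \<beta>2 i + m) ` {..<n2} = {}" using m by fastforce
    then have "card (\<beta>1 ` {..<n1} \<union> (\<lambda>i. \<beta>2 i + m) ` {..<n2}) = card (\<beta>1 ` {..<n1}) + card ((\<lambda>i. \<beta>2 i + m) ` {..<n2})"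
      by (intro card_Un_disjoint) auto
    also have "(\<lambda>i. \<beta>2 i + m) ` {..<n2} = (\<lambda>i. i + m) ` \<beta>2 ` {..<n2}" by (simp add: image_image)
    also have "card \<dots> = card (\<beta>2 ` {..<n2})" by (intro card_image inj_onI) simp
    finally have "k + l \<le> card (\<beta>1 ` {..<n1} \<union> (\<lambda>i. i + m) ` \<beta>2 ` {..<n2})" using 1(3) 2(3) by simp
    also have "\<dots> \<le> card (?\<beta> ` {..<n1+n2})"
    proof (intro card_mono finite_imageI finite_lessThan)
      have "\<beta>1 i \<in> ?\<beta> ` {..<n1+n2}" if "i < n1" for i
        using that by (intro image_eqI[of _ _ i]) auto
      moreover have "\<beta>2 i + m \<in> ?\<beta> ` {..<n1+n2}" if "i < n2" for i
        using that by (intro image_eqI[of _ _ "i + n1"]) auto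
      ultimately show "\<beta>1 ` {..<n1} \<union> (\<lambda>i. i + m) ` \<beta>2 ` {..<n2} \<subseteq> ?\<beta> ` {..<n1+n2}" by blast
    qed
    finally show ?thesis .
  qed
  ultimately show ?thesis unfolding eq
    by (intro fun_span_scale fun_span_base) (auto simp only: coset_gens_def mem_Collect_eq intro!: exI)
qed

lemma HC_ind_lin:
  "HC_ind n1 n2 (\<lambda>x. c * \<phi> x + \<psi> x) = (\<lambda>x. c * HC_ind n1 n2 \<phi> x + HC_ind n1 n2 \<psi> x)"
  by (rule ext) (simp add: HC_ind_def sum.distrib sum_distrib_left algebra_simps del: sum.inter_filter)

lemma HC_ind_scale: "HC_ind n1 n2 (\<lambda>x. c * \<phi> x) = (\<lambda>x. c * HC_ind n1 n2 \<phi> x)"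
  by (rule ext) (simp add: HC_ind_def sum_distrib_left algebra_simps)

lemma HC_ind_zero: "HC_ind n1 n2 (\<lambda>x. 0) = (\<lambda>x. 0)"
  by (rule ext) (simp add: HC_ind_def)

lemma HC_ind_sum: "finite K \<Longrightarrow> HC_ind n1 n2 (\<lambda>x. \<Sum>k\<in>K. \<phi> k x) = (\<lambda>x. \<Sum>k\<in>K. HC_ind n1 n2 (\<phi> k) x)"
proof (induction K rule: finite_induct)
  case (insert k K)
  then show ?case using HC_ind_lin[of n1 n2 1 "\<phi> k" "\<lambda>x. \<Sum>k\<in>K. \<phi> k x"] by simp
qed (simp add: HC_ind_zero)

lemma HC_ind_fun_span:
  assumes "f1 \<in> fun_span (coset_gens n1 k)" "f2 \<in> fun_span (coset_gens n2 l)"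
  shows "HC_ind n1 n2 (ext_prod n1 n2 f1 f2) \<in> fun_span (coset_gens (n1+n2) (k+l))"
  using assms(1)
proof induction
  case fun_span_zero
  show ?case by (simp add: ext_prod_def HC_ind_zero fun_span.fun_span_zero)
next
  case (fun_span_step b w c)
  have "HC_ind n1 n2 (ext_prod n1 n2 b f2) \<in> fun_span (coset_gens (n1+n2) (k+l))"
    using assms(2)
  proof induction
    case fun_span_zero
    show ?case by (simp add: ext_prod_def HC_ind_zero fun_span.fun_span_zero)
  next
    case (fun_span_step b' w c)
    have "ext_prod n1 n2 b (\<lambda>x. c * b' x + w x) = (\<lambda>x. c * ext_prod n1 n2 b b' x + ext_prod n1 n2 b w x)"
      by (simp add: fun_eq_iff ext_prod_def algebra_simps)
    then show ?case
      using HC_ind_coset_gens[OF \<open>b \<in> _\<close> fun_span_step(1)] fun_span_step(3) by (simp add: HC_ind_lin fun_span_lin)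
  qed
  moreover have "ext_prod n1 n2 (\<lambda>x. c * b x + w x) f2 = (\<lambda>x. c * ext_prod n1 n2 b f2 x + ext_prod n1 n2 w f2 x)"
    by (simp add: fun_eq_iff ext_prod_def algebra_simps)
  ultimately show ?case using fun_span_step(3) by (simp add: HC_ind_lin fun_span_lin)
qed

subsection \<open>The grading\<close>

definition cusp_graded :: "nat \<Rightarrow> nat \<Rightarrow> ('a::{finite,field} mat \<Rightarrow> complex) set" where
  "cusp_graded n k = coset_fil n k \<inter> fun_span (coset_gens n k)"

lemma cusp_graded_classfun: "f \<in> cusp_graded n k \<Longrightarrow> f \<in> classfun n"
  by (simp add: cusp_graded_def coset_fil_def)

lemma cusp_graded_zero: "(\<lambda>_. 0) \<in> cusp_graded n k"
  by (simp add: cusp_graded_def coset_fil_def classfun_zero fun_span_zero)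

lemma cusp_graded_lin:
  assumes "f \<in> cusp_graded n k" "h \<in> cusp_graded n k" shows "(\<lambda>x. c * f x + h x) \<in> cusp_graded n k"
  using assms by (auto simp: cusp_graded_def intro: fun_span_lin coset_fil_add coset_fil_scale)

lemma cusp_graded_large:
  assumes "n < k" "f \<in> cusp_graded n k" shows "f = (\<lambda>_. 0)"
proof -
  have "f \<in> fun_span {}" using assms(2) unfolding cusp_graded_def coset_gens_empty[OF assms(1)] by simp
  then show ?thesis by cases auto
qed

lemma HC_ind_cusp_graded:
  "f1 \<in> cusp_graded n1 k \<Longrightarrow> f2 \<in> cusp_graded n2 l \<Longrightarrow>
    HC_ind n1 n2 (ext_prod n1 n2 f1 f2) \<in> cusp_graded (n1+n2) (k+l)"
  by (simp add: cusp_graded_def HC_ind_coset_fil HC_ind_fun_span)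

text \<open>For \<open>k < l\<close> the generators with at least \<open>l\<close> blocks are among
  those with at least \<open>Suc k\<close> blocks, to which \<open>coset_fil n k\<close> is
  orthogonal.\<close>

lemma cusp_graded_orthogonal_less:
  assumes "f \<in> cusp_graded n k" "h \<in> cusp_graded n l" "k < l"
  shows "mat_ip n f h = 0"
proof (rule mat_ip_span)
  show "h \<in> fun_span (coset_gens n (Suc k))"
    using assms fun_span_mono[OF coset_gens_antimono[of "Suc k" l n]] by (auto simp: cusp_graded_def)
  show "mat_ip n f b = 0" if "b \<in> coset_gens n (Suc k)" for b
    using assms(1) that by (simp add: cusp_graded_def coset_fil_iff)
qed

lemma cusp_graded_orthogonal:
  assumes "f \<in> cusp_graded n k" "h \<in> cusp_graded n l" "k \<noteq> l"
  shows "mat_ip n f h = 0"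
proof (cases "k < l")
  case False
  then have "mat_ip n h f = 0" using assms cusp_graded_orthogonal_less[of h n l f k] by simp
  then show ?thesis by (subst mat_ip_cnj) simp
qed (use assms cusp_graded_orthogonal_less in blast)

lemma cusp_graded_independent:
  assumes a: "\<And>k. a k \<in> cusp_graded n k" and s: "\<And>x. (\<Sum>k\<le>n. a k x) = 0" and l: "l \<le> n"
  shows "a l = (\<lambda>_. 0)"
proof -
  have "mat_ip n (a k) (a l) = (if k = l then mat_ip n (a l) (a l) else 0)" for k
    using cusp_graded_orthogonal[OF a a, of k l] by auto
  then have "mat_ip n (\<lambda>x. \<Sum>k\<le>n. a k x) (a l) = (\<Sum>k\<le>n. if k = l then mat_ip n (a l) (a l) else 0)"
    unfolding mat_ip_sum by simp
  also have "\<dots> = mat_ip n (a l) (a l)" using l by simp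
  finally have "mat_ip n (a l) (a l) = 0" using s by (simp add: mat_ip_def)
  then show ?thesis
    using mat_ip_self_eq_0[of n "a l"] classfun_outside[OF cusp_graded_classfun[OF a[of l]]] by blast
qed

text \<open>Downward induction from \<open>Suc n\<close>, where no generators exist. Projecting
  \<open>w\<close> to the span for \<open>Suc j\<close> leaves a residue that is orthogonal to that
  span but still in the span for \<open>j\<close>, hence of degree exactly \<open>j\<close>.\<close>

lemma cusp_graded_decomp_aux:
  "j \<le> Suc n \<Longrightarrow> w \<in> fun_span (coset_gens n j) \<Longrightarrow>
    \<exists>a. (\<forall>k. a k \<in> cusp_graded n k) \<and> w = (\<lambda>x. \<Sum>k\<in>{j..n}. a k x)"
proof (induction arbitrary: w rule: inc_induct)
  case base
  then have "w \<in> fun_span {}" by (simp add: coset_gens_empty)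
  then have "w = (\<lambda>_. 0)" by cases auto
  then show ?case by (intro exI[of _ "\<lambda>_ _. 0"]) (simp add: cusp_graded_zero)
next
  case (step j)
  obtain w' where w': "w' \<in> fun_span (coset_gens n (Suc j))"
    and o: "\<forall>b\<in>coset_gens n (Suc j). mat_ip n (\<lambda>x. w x - w' x) b = 0"
    using orthogonal_projection[OF finite_coset_gens[of n "Suc j"], of n w] by blast
  have "w' \<in> fun_span (coset_gens n j)" using w' fun_span_mono[OF coset_gens_antimono[of j "Suc j" n]] by auto
  then have d: "(\<lambda>x. w x - w' x) \<in> fun_span (coset_gens n j)" using step.prems by (intro fun_span_diff)
  then have r: "(\<lambda>x. w x - w' x) \<in> cusp_graded n j"
    using o fun_span_classfun[OF coset_gens_classfun] by (auto simp: cusp_graded_def coset_fil_iff)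
  obtain a where a: "\<forall>k. a k \<in> cusp_graded n k" and w'a: "w' = (\<lambda>x. \<Sum>k\<in>{Suc j..n}. a k x)"
    using step.IH[OF w'] by blast
  define a' where "a' = a(j := (\<lambda>x. w x - w' x))"
  have "(\<Sum>k\<in>{j..n}. a' k x) = w x" for x
  proof -
    have "(\<Sum>k\<in>{j..n}. a' k x) = a' j x + (\<Sum>k\<in>{Suc j..n}. a' k x)"
      using step.hyps by (simp add: sum.atLeast_Suc_atMost)
    also have "(\<Sum>k\<in>{Suc j..n}. a' k x) = (\<Sum>k\<in>{Suc j..n}. a k x)"
      by (intro sum.cong) (auto simp: a'_def)
    finally show ?thesis by (simp add: a'_def w'a)
  qed
  moreover have "\<forall>k. a' k \<in> cusp_graded n k" using a r by (simp add: a'_def)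
  ultimately show ?case by (intro exI[of _ a']) auto
qed

lemma cusp_graded_decomp:
  assumes "f \<in> classfun n"
  obtains a where "\<And>k. a k \<in> cusp_graded n k" "f = (\<lambda>x. \<Sum>k\<le>n. a k x)"
proof -
  have "f \<in> fun_span (coset_gens n 0)" by (rule classfun_in_span[OF assms]) auto
  from cusp_graded_decomp_aux[OF _ this] obtain a
    where "\<forall>k. a k \<in> cusp_graded n k" "f = (\<lambda>x. \<Sum>k\<in>{0..n}. a k x)" by auto
  then show thesis using that[of a] by (simp add: atMost_atLeast0)
qed

subsection \<open>The duality operator\<close>

text \<open>The exponent \<open>n + k\<close> has the parity of n - k and avoids truncated
  subtraction. The choice operator is harmless on class functions, since their graded decomposition
  exists and is unique.\<close>

definition cusp_dual :: "nat \<Rightarrow> ('a::{finite,field} mat \<Rightarrow> complex) \<Rightarrow> 'a mat \<Rightarrow> complex" where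
  "cusp_dual n f = (SOME h. \<exists>a. (\<forall>k. a k \<in> cusp_graded n k) \<and> f = (\<lambda>x. \<Sum>k\<le>n. a k x) \<and>
     h = (\<lambda>x. \<Sum>k\<le>n. (-1) ^ (n + k) * a k x))"

text \<open>Well-definedness: the difference of two decompositions is a graded sum equal to zero, so
  each component vanishes by orthogonality.\<close>

lemma cusp_dual_sum:
  assumes a: "\<And>k. a k \<in> cusp_graded n k"
  shows "cusp_dual n (\<lambda>x. \<Sum>k\<le>n. a k x) = (\<lambda>x. \<Sum>k\<le>n. (-1) ^ (n + k) * a k x)"
  unfolding cusp_dual_def
proof (rule some_equality)
  show "\<exists>a'. (\<forall>k. a' k \<in> cusp_graded n k) \<and> (\<lambda>x. \<Sum>k\<le>n. a k x) = (\<lambda>x. \<Sum>k\<le>n. a' k x) \<and>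
     (\<lambda>x. \<Sum>k\<le>n. (-1) ^ (n + k) * a k x) = (\<lambda>x. \<Sum>k\<le>n. (-1) ^ (n + k) * a' k x)"
    using a by blast
next
  fix h assume "\<exists>a'. (\<forall>k. a' k \<in> cusp_graded n k) \<and> (\<lambda>x. \<Sum>k\<le>n. a k x) = (\<lambda>x. \<Sum>k\<le>n. a' k x) \<and>
     h = (\<lambda>x. \<Sum>k\<le>n. (-1) ^ (n + k) * a' k x)"
  then obtain a' where a': "\<forall>k. a' k \<in> cusp_graded n k" and eq: "(\<lambda>x. \<Sum>k\<le>n. a k x) = (\<lambda>x. \<Sum>k\<le>n. a' k x)"
    and h: "h = (\<lambda>x. \<Sum>k\<le>n. (-1) ^ (n + k) * a' k x)" by blast
  have "a' l x = a l x" if "l \<le> n" for l x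
  proof -
    have "(\<lambda>x. (-1) * a' l x + a l x) = (\<lambda>_. 0)"
    proof (rule cusp_graded_independent[where a = "\<lambda>l x. (-1) * a' l x + a l x" and n = n])
      show "(\<lambda>x. (-1) * a' k x + a k x) \<in> cusp_graded n k" for k
        using a a' by (intro cusp_graded_lin) auto
      show "(\<Sum>k\<le>n. (-1) * a' k x + a k x) = 0" for x
        using fun_cong[OF eq, of x] by (simp add: sum_subtractf)
    qed (rule that)
    from fun_cong[OF this, of x] show ?thesis by simp
  qed
  then show "h = (\<lambda>x. \<Sum>k\<le>n. (-1) ^ (n + k) * a k x)" unfolding h by (intro ext sum.cong) auto
qed

lemma cusp_dual_lin:
  assumes "f \<in> classfun n" "h \<in> classfun n"
  shows "cusp_dual n (\<lambda>x. c * f x + h x) = (\<lambda>x. c * cusp_dual n f x + cusp_dual n h x)"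
proof -
  obtain a where a: "\<And>k. a k \<in> cusp_graded n k" "f = (\<lambda>x. \<Sum>k\<le>n. a k x)" using cusp_graded_decomp[OF assms(1)] by blast
  obtain b where b: "\<And>k. b k \<in> cusp_graded n k" "h = (\<lambda>x. \<Sum>k\<le>n. b k x)" using cusp_graded_decomp[OF assms(2)] by blast
  have "(\<lambda>x. c * f x + h x) = (\<lambda>x. \<Sum>k\<le>n. c * a k x + b k x)"
    by (simp add: a(2) b(2) sum.distrib sum_distrib_left)
  then have "cusp_dual n (\<lambda>x. c * f x + h x) = (\<lambda>x. \<Sum>k\<le>n. (-1) ^ (n + k) * (c * a k x + b k x))"
    using cusp_dual_sum[of "\<lambda>k x. c * a k x + b k x" n, OF cusp_graded_lin[OF a(1) b(1)]] by simp
  moreover have "cusp_dual n f = (\<lambda>x. \<Sum>k\<le>n. (-1) ^ (n + k) * a k x)" unfolding a(2) by (rule cusp_dual_sum[OF a(1)])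
  moreover have "cusp_dual n h = (\<lambda>x. \<Sum>k\<le>n. (-1) ^ (n + k) * b k x)" unfolding b(2) by (rule cusp_dual_sum[OF b(1)])
  ultimately show ?thesis by (simp add: sum.distrib sum_distrib_left algebra_simps)
qed

lemma cusp_dual_zero: "cusp_dual n (\<lambda>_. 0) = (\<lambda>_. 0)"
  using cusp_dual_sum[of "\<lambda>_ _. 0" n, OF cusp_graded_zero] by simp

lemma cusp_dual_classfun:
  assumes "f \<in> classfun n" shows "cusp_dual n f \<in> classfun n"
proof -
  obtain a where a: "\<And>k. a k \<in> cusp_graded n k" "f = (\<lambda>x. \<Sum>k\<le>n. a k x)" using cusp_graded_decomp[OF assms] by blast
  show ?thesis unfolding a(2) cusp_dual_sum[OF a(1)]
    by (intro classfun_sum classfun_scale cusp_graded_classfun[OF a(1)])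
qed

lemma lin_endo_cusp_dual: "lin_endo n (cusp_dual n)"
  unfolding lin_endo_def
proof (intro conjI ballI allI)
  fix f h :: "'a mat \<Rightarrow> complex" and c
  assume f: "f \<in> classfun n"
  show "cusp_dual n f \<in> classfun n" by (rule cusp_dual_classfun[OF f])
  show "cusp_dual n (\<lambda>x. c * f x) = (\<lambda>x. c * cusp_dual n f x)"
    using cusp_dual_lin[OF f classfun_zero, of c] by (simp add: cusp_dual_zero)
  assume "h \<in> classfun n"
  then show "cusp_dual n (\<lambda>x. f x + h x) = (\<lambda>x. cusp_dual n f x + cusp_dual n h x)"
    using cusp_dual_lin[OF f, of h 1] by simp
qed

lemma lin_endo_sum:
  assumes T: "lin_endo n T" and K: "finite K" "\<And>k. k \<in> K \<Longrightarrow> a k \<in> classfun n"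
  shows "T (\<lambda>x. \<Sum>k\<in>K. a k x) = (\<lambda>x. \<Sum>k\<in>K. T (a k) x)"
  using K
proof (induction K rule: finite_induct)
  case empty
  have "\<forall>c. \<forall>f \<in> classfun n. T (\<lambda>x. c * f x) = (\<lambda>x. c * T f x)"
    using T by (simp add: lin_endo_def)
  from this[rule_format, OF classfun_zero, of 0] show ?case by simp
next
  case (insert k K)
  have "\<forall>f \<in> classfun n. \<forall>h \<in> classfun n. T (\<lambda>x. f x + h x) = (\<lambda>x. T f x + T h x)"
    using T by (simp add: lin_endo_def)
  from this[rule_format, of "a k" "\<lambda>x. \<Sum>k\<in>K. a k x"]
  have "T (\<lambda>x. a k x + (\<Sum>k\<in>K. a k x)) = (\<lambda>x. T (a k) x + T (\<lambda>x. \<Sum>k\<in>K. a k x) x)"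
    using insert.prems by (simp add: classfun_sum)
  then show ?case using insert by simp
qed

lemma cusp_dual_graded:
  assumes f: "f \<in> cusp_graded n k"
  shows "cusp_dual n f = (\<lambda>x. (-1) ^ (n + k) * f x)"
proof (cases "k \<le> n")
  case True
  have "f = (\<lambda>x. \<Sum>j\<le>n. (if j = k then f else (\<lambda>_. 0)) x)"
  proof
    fix x
    have "(\<Sum>j\<le>n. (if j = k then f else (\<lambda>_. 0)) x) = (\<Sum>j\<le>n. if j = k then f x else 0)"
      by (intro sum.cong) auto
    then show "f x = (\<Sum>j\<le>n. (if j = k then f else (\<lambda>_. 0)) x)" using True by simp
  qed
  then have "cusp_dual n f = cusp_dual n (\<lambda>x. \<Sum>j\<le>n. (if j = k then f else (\<lambda>_. 0)) x)" by simp
  also have "\<dots> = (\<lambda>x. \<Sum>j\<le>n. (-1) ^ (n + j) * (if j = k then f else (\<lambda>_. 0)) x)"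
    by (rule cusp_dual_sum) (use f cusp_graded_zero in auto)
  also have "\<dots> = (\<lambda>x. (-1) ^ (n + k) * f x)"
  proof
    fix x
    have "(\<Sum>j\<le>n. (-1) ^ (n + j) * (if j = k then f else (\<lambda>_. 0)) x) = (\<Sum>j\<le>n. if j = k then (-1) ^ (n + k) * f x else 0)"
      by (intro sum.cong) auto
    then show "(\<Sum>j\<le>n. (-1) ^ (n + j) * (if j = k then f else (\<lambda>_. 0)) x) = (-1) ^ (n + k) * f x" using True by simp
  qed
  finally show ?thesis .
next
  case False
  then have "f = (\<lambda>_. 0)" using cusp_graded_large f by (metis not_le_imp_less)
  then show ?thesis by (simp add: cusp_dual_zero)
qed

lemma HC_ind_ext_prod_sum:
  assumes "finite K" "finite L"
  shows "HC_ind n1 n2 (ext_prod n1 n2 (\<lambda>x. \<Sum>k\<in>K. a k x) (\<lambda>x. \<Sum>l\<in>L. b l x)) =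
    (\<lambda>x. \<Sum>k\<in>K. \<Sum>l\<in>L. HC_ind n1 n2 (ext_prod n1 n2 (a k) (b l)) x)"
proof -
  have "ext_prod n1 n2 (\<lambda>x. \<Sum>k\<in>K. a k x) (\<lambda>x. \<Sum>l\<in>L. b l x) = (\<lambda>x. \<Sum>k\<in>K. \<Sum>l\<in>L. ext_prod n1 n2 (a k) (b l) x)"
    by (simp add: fun_eq_iff ext_prod_def sum_product)
  then show ?thesis using assms by (simp add: HC_ind_sum)
qed

lemma HC_ind_ext_prod_scale:
  "HC_ind n1 n2 (ext_prod n1 n2 (\<lambda>x. c * f x) (\<lambda>x. d * h x)) = (\<lambda>x. c * d * HC_ind n1 n2 (ext_prod n1 n2 f h) x)"
proof -
  have "ext_prod n1 n2 (\<lambda>x. c * f x) (\<lambda>x. d * h x) = (\<lambda>x. c * d * ext_prod n1 n2 f h x)"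
    by (simp add: fun_eq_iff ext_prod_def)
  then show ?thesis by (simp add: HC_ind_scale)
qed

text \<open>Induction is bilinear and adds degrees, and the exponent of the sign is additive in both
  size and degree; so the signs multiply component by component.\<close>

lemma cusp_dual_HC_ind:
  assumes "f1 \<in> classfun n1" "f2 \<in> classfun n2"
  shows "cusp_dual (n1+n2) (HC_ind n1 n2 (ext_prod n1 n2 f1 f2)) =
    HC_ind n1 n2 (ext_prod n1 n2 (cusp_dual n1 f1) (cusp_dual n2 f2))"
proof -
  obtain a where a: "\<And>k. a k \<in> cusp_graded n1 k" "f1 = (\<lambda>x. \<Sum>k\<le>n1. a k x)" using cusp_graded_decomp[OF assms(1)] by blast
  obtain b where b: "\<And>k. b k \<in> cusp_graded n2 k" "f2 = (\<lambda>x. \<Sum>k\<le>n2. b k x)" using cusp_graded_decomp[OF assms(2)] by blast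
  let ?H = "\<lambda>k l. HC_ind n1 n2 (ext_prod n1 n2 (a k) (b l))"
  note T = lin_endo_cusp_dual[of "n1+n2"]
  have H: "?H k l \<in> cusp_graded (n1+n2) (k+l)" for k l by (rule HC_ind_cusp_graded[OF a(1) b(1)])
  note Hc = cusp_graded_classfun[OF H]
  have inner: "(\<lambda>x. \<Sum>l\<le>n2. ?H k l x) \<in> classfun (n1+n2)" for k by (rule classfun_sum[OF Hc])
  have "HC_ind n1 n2 (ext_prod n1 n2 f1 f2) = (\<lambda>x. \<Sum>k\<le>n1. \<Sum>l\<le>n2. ?H k l x)"
    unfolding a(2) b(2) by (rule HC_ind_ext_prod_sum) auto
  then have "cusp_dual (n1+n2) (HC_ind n1 n2 (ext_prod n1 n2 f1 f2)) = (\<lambda>x. \<Sum>k\<le>n1. cusp_dual (n1+n2) (\<lambda>x. \<Sum>l\<le>n2. ?H k l x) x)"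
    using lin_endo_sum[OF T, of "{..n1}" "\<lambda>k x. \<Sum>l\<le>n2. ?H k l x"] inner by simp
  also have "\<dots> = (\<lambda>x. \<Sum>k\<le>n1. \<Sum>l\<le>n2. cusp_dual (n1+n2) (?H k l) x)"
    by (simp add: lin_endo_sum[OF T _ Hc])
  also have "\<dots> = (\<lambda>x. \<Sum>k\<le>n1. \<Sum>l\<le>n2. (-1) ^ (n1 + k) * (-1) ^ (n2 + l) * ?H k l x)"
    by (simp add: cusp_dual_graded[OF H] power_add algebra_simps)
  also have "\<dots> = HC_ind n1 n2 (ext_prod n1 n2 (\<lambda>x. \<Sum>k\<le>n1. (-1) ^ (n1 + k) * a k x) (\<lambda>x. \<Sum>l\<le>n2. (-1) ^ (n2 + l) * b l x))"
    by (simp add: HC_ind_ext_prod_sum HC_ind_ext_prod_scale)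
  also have "\<dots> = HC_ind n1 n2 (ext_prod n1 n2 (cusp_dual n1 f1) (cusp_dual n2 f2))"
    unfolding a(2) b(2) cusp_dual_sum[OF a(1)] cusp_dual_sum[OF b(1)] ..
  finally show ?thesis .
qed

subsection \<open>Pre-cuspidal functions\<close>

text \<open>Maximal parabolics suffice, because the unipotent radical of a proper standard parabolic
  contains that of a maximal one, and larger coset sums break up into smaller ones.\<close>

lemma coset_fil_1_two_blockI:
  fixes f :: "'a::{finite,field} mat \<Rightarrow> complex"
  assumes f: "f \<in> classfun n"
    and *: "\<And>n1 x. 0 < n1 \<Longrightarrow> n1 < n \<Longrightarrow> x \<in> color_parab n (two_block n1) \<Longrightarrow>
      (\<Sum>y \<in> color_coset n (two_block n1) x. f y) = 0"
  shows "f \<in> coset_fil n 1"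
proof (rule coset_filI_mono[OF f])
  fix \<gamma> and x :: "'a mat"
  assume mono: "\<And>i j. i \<le> j \<Longrightarrow> j < n \<Longrightarrow> \<gamma> i \<le> (\<gamma> j :: nat)" and x: "x \<in> color_parab n \<gamma>"
    and card: "1 < card (\<gamma> ` {..<n})"
  have "\<exists>i. i < n \<and> \<gamma> i \<noteq> \<gamma> 0"
  proof (rule ccontr)
    assume "\<not> ?thesis"
    then have "\<gamma> ` {..<n} \<subseteq> {\<gamma> 0}" by blast
    then have "card (\<gamma> ` {..<n}) \<le> 1" using card_mono[of "{\<gamma> 0}"] by simp
    with card show False by simp
  qed
  \<comment> \<open>The end of the first block: by monotonicity all later indices have a strictly
    larger colour than those before it.\<close>
  define n1 where "n1 = (LEAST i. i < n \<and> \<gamma> i \<noteq> \<gamma> 0)"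
  have n1: "n1 < n" "\<gamma> n1 \<noteq> \<gamma> 0"
    using LeastI_ex[OF \<open>\<exists>i. _\<close>] by (auto simp: n1_def)
  have lt: "\<gamma> i = \<gamma> 0" if "i < n1" for i
    using not_less_Least[of i "\<lambda>i. i < n \<and> \<gamma> i \<noteq> \<gamma> 0"] that n1(1) by (simp add: n1_def)
  have pos: "0 < n1" using n1(2) by (cases n1) auto
  have sep: "\<gamma> i < \<gamma> j" if "i < n1" "n1 \<le> j" "j < n" for i j
    using lt[OF that(1)] mono[OF that(2,3)] mono[of 0 n1] n1 by simp
  let ?N = "{(i,j). i < n1 \<and> n1 \<le> j \<and> j < n}"
  show "(\<Sum>y \<in> color_coset n \<gamma> x. f y) = 0"
  proof (rule sum_entry_coset_eq_0[of ?N])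
    show "?N \<subseteq> {(i,j). \<gamma> i < \<gamma> j}" using sep by auto
    fix y assume "y \<in> color_coset n \<gamma> x"
    then have y: "y \<in> color_parab n \<gamma>" by (rule color_coset_parab[OF x])
    have "y $$ (i,j) = 0" if "i < n" "j < n" "two_block n1 j < two_block n1 i" for i j
      using y that sep[of j i] by (auto simp: color_parab_def two_block_def split: if_splits)
    then have "y \<in> color_parab n (two_block n1)" using color_parab_carrier[OF y] by (simp add: color_parab_def)
    moreover have "entry_coset n ?N y = color_coset n (two_block n1) y"
      by (auto simp: entry_coset_def two_block_def)
    ultimately show "(\<Sum>y' \<in> entry_coset n ?N y. f y') = 0" using *[OF pos n1(1)] by simp
  qed
qed

lemma color_nil_carrier: "u \<in> color_nil n \<beta> \<Longrightarrow> u \<in> carrier_mat n n"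
  by (simp add: color_nil_def)

lemma mat_add_left_cancel:
  assumes "x \<in> carrier_mat n n" "u \<in> carrier_mat n n" "v \<in> carrier_mat n n" "x + u = x + (v :: 'a::field mat)"
  shows "u = v"
proof (rule eq_matI)
  fix i j assume "i < dim_row v" "j < dim_col v"
  then have ij: "i < n" "j < n" using assms by auto
  have "(x + u) $$ (i,j) = (x + v) $$ (i,j)" using assms(4) by simp
  then show "u $$ (i,j) = v $$ (i,j)" using assms(1-3) ij by simp
qed (use assms in auto)

lemma sum_color_nil:
  assumes x: "x \<in> carrier_mat n n"
  shows "(\<Sum>u\<in>color_nil n \<beta>. f (x + u)) = (\<Sum>y\<in>color_coset n \<beta> x. f y)"
proof -
  have "color_coset n \<beta> x = (\<lambda>u. x + u) ` color_nil n \<beta>" using color_coset_iff[OF x] by blast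
  moreover have "inj_on (\<lambda>u. x + u) (color_nil n \<beta>)"
    by (rule inj_onI) (rule mat_add_left_cancel[OF x]; simp add: color_nil_carrier)
  ultimately show ?thesis by (simp add: sum.reindex)
qed

text \<open>Pre-cuspidality ranges over all conjugate Levi subalgebras. Invariance of
  \<open>f\<close> pulls each restriction back to the standard one, where it is a coset sum up to a
  nonzero factor.\<close>

lemma HC_res_eq_0_iff:
  assumes f: "f \<in> classfun (sum_list ns)" and g: "g \<in> GLn (sum_list ns)" and l: "l \<in> carrier_mat (sum_list ns) (sum_list ns)"
  shows "HC_res ns g f (conjm g l) = 0 \<longleftrightarrow> (\<Sum>y\<in>color_coset (sum_list ns) (blk ns) l. f y) = (0 :: complex)"
proof -
  let ?n = "sum_list ns" and ?U = "color_nil (sum_list ns) (blk ns) :: 'a mat set"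
  have Uc: "?U \<subseteq> carrier_mat ?n ?n" using color_nil_carrier by blast
  have inj: "inj_on (conjm g) ?U"
    using bij_conjm[OF g] Uc unfolding bij_betw_def by (blast intro: inj_on_subset)
  have "0\<^sub>m ?n ?n \<in> ?U" by (simp add: color_nil_def)
  moreover have "finite ?U" using Uc finite_subset finite_carrier_mat by blast
  ultimately have c: "card (conjm g ` ?U) \<noteq> 0" unfolding card_image[OF inj] by auto
  have "(\<Sum>y\<in>conjm g ` ?U. f (conjm g l + y)) = (\<Sum>u\<in>?U. f (conjm g l + conjm g u))"
    by (simp add: sum.reindex[OF inj])
  also have "\<dots> = (\<Sum>u\<in>?U. f (l + u))"
  proof (rule sum.cong[OF refl])
    fix u assume "u \<in> ?U"
    then have u: "u \<in> carrier_mat ?n ?n" by (rule color_nil_carrier)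
    show "f (conjm g l + conjm g u) = f (l + u)"
      using conjm_add[OF g l u] classfun_conjm[OF f g, of "l + u"] l u by simp
  qed
  also have "\<dots> = (\<Sum>y\<in>color_coset ?n (blk ns) l. f y)" by (rule sum_color_nil[OF l])
  finally show ?thesis using c unfolding HC_res_def unip_alg_eq by simp
qed

lemma entry_coset_cong:
  assumes "\<And>i j. i < n \<Longrightarrow> j < n \<Longrightarrow> (i,j) \<in> N \<longleftrightarrow> (i,j) \<in> N'"
    and "\<And>i j. i < n \<Longrightarrow> j < n \<Longrightarrow> (i,j) \<notin> N \<Longrightarrow> x $$ (i,j) = x' $$ (i,j)"
  shows "entry_coset n N x = entry_coset n N' x'"
  unfolding entry_coset_def by (intro Collect_cong conj_cong refl iff_allI imp_cong) (simp_all add: assms)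

lemma pre_cuspidal_imp_coset_fil:
  fixes f :: "'a::{finite,field} mat \<Rightarrow> complex"
  assumes f: "f \<in> classfun n" and p: "pre_cuspidal n f"
  shows "f \<in> coset_fil n 1"
proof (rule coset_fil_1_two_blockI[OF f])
  fix n1 and x :: "'a mat" assume n1: "0 < n1" "n1 < n" and x: "x \<in> color_parab n (two_block n1)"
  let ?ns = "[n1, n - n1]"
  have n: "sum_list ?ns = n" "n1 + (n - n1) = n" using n1 by auto
  \<comment> \<open>Restriction is evaluated only at Levi elements, while the filtration tests all
    \<open>x\<close> in the parabolic. The Levi part \<open>l\<close> differs from \<open>x\<close>
    only in free positions, so both give the same coset.\<close>
  define l where "l = mat n n (\<lambda>(i,j). if two_block n1 i = two_block n1 j then x $$ (i,j) else 0)"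
  have b: "blk ?ns i = two_block n1 i" if "i < n" for i using blk_two[of i n1 "n - n1"] that n by simp
  have lc: "l \<in> carrier_mat n n" by (simp add: l_def)
  then have "l \<in> levi_alg ?ns" unfolding levi_alg_def n(1) by (auto simp: l_def b)
  then have "conjm (1\<^sub>m n) l \<in> conjm (1\<^sub>m n) ` levi_alg ?ns" by (rule imageI)
  moreover have "\<forall>x \<in> conjm (1\<^sub>m n) ` levi_alg ?ns. HC_res ?ns (1\<^sub>m n) f x = 0"
    using p n1 unfolding pre_cuspidal_def by (auto simp del: conjm_one dest!: spec[of _ ?ns])
  ultimately have "HC_res ?ns (1\<^sub>m n) f (conjm (1\<^sub>m n) l) = 0" by blast
  then have "(\<Sum>y\<in>color_coset n (blk ?ns) l. f y) = 0"
    using HC_res_eq_0_iff[of f ?ns "1\<^sub>m n" l] f lc unfolding n(1) by simp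
  moreover have "color_coset n (blk ?ns) l = color_coset n (two_block n1) x"
  proof (rule entry_coset_cong)
    fix i j assume ij: "i < n" "j < n"
    show "(i,j) \<in> {(i,j). blk ?ns i < blk ?ns j} \<longleftrightarrow> (i,j) \<in> {(i,j). two_block n1 i < two_block n1 j}"
      using ij by (simp add: b)
    assume "(i,j) \<notin> {(i,j). blk ?ns i < blk ?ns j}"
    then show "l $$ (i,j) = x $$ (i,j)" using ij x by (auto simp: l_def b color_parab_def)
  qed
  ultimately show "(\<Sum>y\<in>color_coset n (two_block n1) x. f y) = 0" by simp
qed

lemma card_blk:
  assumes "length ns \<ge> 2" "\<forall>m \<in> set ns. m > 0"
  shows "1 < card (blk ns ` {..<sum_list ns})"
proof -
  obtain a b r where ns: "ns = a # b # r" using assms(1) by (cases ns; cases "tl ns") auto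
  have ab: "a > 0" "b > 0" using assms(2) by (auto simp: ns)
  have "{k. k < length ns \<and> sum_list (take (Suc k) ns) \<le> 0} = {}" using ab by (auto simp: ns)
  then have 0: "blk ns 0 = 0" by (simp add: blk_def)
  \<comment> \<open>The index \<open>a\<close> is the start of the second block, so the first block
    already counts as finished there.\<close>
  have "0 \<in> {k. k < length ns \<and> sum_list (take (Suc k) ns) \<le> a}" by (simp add: ns)
  then have "card {k. k < length ns \<and> sum_list (take (Suc k) ns) \<le> a} \<noteq> 0"
    by (subst card_eq_0_iff) auto
  then have "blk ns a \<noteq> 0" by (simp add: blk_def)
  then have "card {blk ns 0, blk ns a} = 2" using 0 by simp
  moreover have "{blk ns 0, blk ns a} \<subseteq> blk ns ` {..<sum_list ns}" using ab by (auto simp: ns)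
  ultimately show ?thesis using card_mono[of "blk ns ` {..<sum_list ns}" "{blk ns 0, blk ns a}"] by simp
qed

text \<open>This direction serves uniqueness, where a function known only through vanishing coset
  sums must be brought under condition (ii). Positive parts guarantee that at least two colours
  occur.\<close>

lemma coset_fil_imp_pre_cuspidal:
  fixes f :: "'a::{finite,field} mat \<Rightarrow> complex"
  assumes f: "f \<in> coset_fil n 1"
  shows "pre_cuspidal n f"
  unfolding pre_cuspidal_def
proof (intro allI ballI impI)
  fix ns and g x :: "'a mat"
  assume g: "g \<in> GLn n" and ns: "sum_list ns = n \<and> length ns \<ge> 2 \<and> (\<forall>m \<in> set ns. m > 0)"
    and x: "x \<in> conjm g ` levi_alg ns"
  obtain l where l: "x = conjm g l" "l \<in> levi_alg ns" using x by blast
  have lc: "l \<in> carrier_mat (sum_list ns) (sum_list ns)" using l(2) by (simp add: levi_alg_def)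
  have "l \<in> color_parab n (blk ns)" using l(2) ns by (auto simp: levi_alg_def color_parab_def)
  moreover have "1 < card (blk ns ` {..<n})" using card_blk[of ns] ns by simp
  ultimately have "(\<Sum>y\<in>color_coset n (blk ns) l. f y) = 0" using f unfolding coset_fil_def by blast
  then show "HC_res ns g f x = 0"
    using HC_res_eq_0_iff[of f ns g l] f g lc ns unfolding l(1) coset_fil_def by simp
qed

section \<open>Existence and uniqueness of the duality family\<close>

lemma duality_family_cusp_dual: "duality_family (cusp_dual :: nat \<Rightarrow> ('a::{finite,field} mat \<Rightarrow> complex) \<Rightarrow> 'a mat \<Rightarrow> complex)"
  unfolding duality_family_def
proof (intro conjI allI ballI impI)
  show "lin_endo n (cusp_dual n)" for n by (rule lin_endo_cusp_dual)
  show "cusp_dual 0 f = f" if "f \<in> classfun 0" for f :: "'a mat \<Rightarrow> complex"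
  proof -
    \<comment> \<open>For size zero no colour is ever used, so the filtration condition is vacuous
      and every function has degree 0.\<close>
    have "f \<in> coset_fil 0 0" using that by (simp add: coset_fil_def)
    then have "f \<in> cusp_graded 0 0" using classfun_in_span[OF that, of 0] by (simp add: cusp_graded_def)
    then show ?thesis by (simp add: cusp_dual_graded)
  qed
  show "cusp_dual (n1+n2) (HC_ind n1 n2 (ext_prod n1 n2 f1 f2)) =
      HC_ind n1 n2 (ext_prod n1 n2 (cusp_dual n1 f1) (cusp_dual n2 f2))"
    if "f1 \<in> classfun n1" "f2 \<in> classfun n2" for n1 n2 and f1 f2 :: "'a mat \<Rightarrow> complex"
    by (rule cusp_dual_HC_ind[OF that])
  show "cusp_dual n f = (\<lambda>x. (-1) ^ (n - 1) * f x)"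
    if n: "n \<ge> 1" and f: "f \<in> classfun n" and p: "pre_cuspidal n f" for n and f :: "'a mat \<Rightarrow> complex"
  proof -
    \<comment> \<open>For \<open>n \<ge> 1\<close> the span in degree 1 is all of
      \<open>classfun n\<close>, so only the filtration condition has content.\<close>
    have "f \<in> cusp_graded n 1"
      unfolding cusp_graded_def using pre_cuspidal_imp_coset_fil[OF f p] classfun_in_span[OF f _ n] by simp
    then have "cusp_dual n f = (\<lambda>x. (-1) ^ (n + 1) * f x)" by (rule cusp_dual_graded)
    moreover have "n + 1 = (n - 1) + 2" using n by simp
    ultimately show ?thesis by (simp only: power_add) simp
  qed
qed

text \<open>Each \<open>f\<close> splits as \<open>w + r\<close>: the part \<open>w\<close> is
  spanned by functions induced from smaller sizes and is controlled by (i) and the induction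
  hypothesis, the residue \<open>r\<close> is pre-cuspidal and is controlled by (ii).\<close>

lemma duality_family_unique:
  fixes D D' :: "nat \<Rightarrow> ('a::{finite,field} mat \<Rightarrow> complex) \<Rightarrow> 'a mat \<Rightarrow> complex"
  assumes D: "duality_family D" and D': "duality_family D'"
  shows "f \<in> classfun n \<Longrightarrow> D' n f = D n f"
proof (induction n arbitrary: f rule: less_induct)
  case (less n)
  have lin: "lin_endo n (D n)" "lin_endo n (D' n)" using D D' by (simp_all add: duality_family_def)
  have add: "D n (\<lambda>x. c * f x + h x) = (\<lambda>x. c * D n f x + D n h x)"
    "D' n (\<lambda>x. c * f x + h x) = (\<lambda>x. c * D' n f x + D' n h x)"
    if "f \<in> classfun n" "h \<in> classfun n" for c f h
    using lin that classfun_scale[OF that(1), of c] unfolding lin_endo_def by simp_all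
  have mult: "E (n1+n2) (HC_ind n1 n2 (ext_prod n1 n2 f1 f2)) = HC_ind n1 n2 (ext_prod n1 n2 (E n1 f1) (E n2 f2))"
    if "duality_family E" "0 < n1" "0 < n2" "f1 \<in> classfun n1" "f2 \<in> classfun n2"
    for E :: "nat \<Rightarrow> ('a mat \<Rightarrow> complex) \<Rightarrow> 'a mat \<Rightarrow> complex" and n1 n2 f1 f2
    using that unfolding duality_family_def by blast
  show ?case
  proof (cases "n = 0")
    case True
    then show ?thesis using D D' less.prems by (simp add: duality_family_def)
  next
    case False
    \<comment> \<open>Two-block averages are enough: they detect pre-cuspidality, and each is a
      nonzero multiple of a function induced from two strictly smaller sizes.\<close>
    define S :: "('a mat \<Rightarrow> complex) set" where
      "S = {coset_avg n (two_block n1) x | n1 x. 0 < n1 \<and> n1 < n \<and> x \<in> color_parab n (two_block n1)}"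
    have "finite S" by (rule finite_coset_avgs[of _ n]) (auto simp: S_def)
    then obtain w where w: "w \<in> fun_span S" and o: "\<forall>b\<in>S. mat_ip n (\<lambda>x. f x - w x) b = 0"
      using orthogonal_projection[of S n f] by blast
    have Sc: "S \<subseteq> classfun n" using coset_avg_classfun by (auto simp: S_def)
    note wc = fun_span_classfun[OF Sc]
    define r where "r = (\<lambda>x. f x - w x)"
    have rc: "r \<in> classfun n" unfolding r_def
      using classfun_lin[OF wc[OF w] less.prems, of "-1"] by simp
    have "r \<in> coset_fil n 1"
    proof (rule coset_fil_1_two_blockI[OF rc])
      fix n1 and x :: "'a mat" assume "0 < n1" "n1 < n" "x \<in> color_parab n (two_block n1)"
      then have "coset_avg n (two_block n1) x \<in> S" unfolding S_def by blast
      then have "mat_ip n r (coset_avg n (two_block n1) x) = 0" using o unfolding r_def by blast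
      then show "(\<Sum>y\<in>color_coset n (two_block n1) x. r y) = 0"
        unfolding mat_ip_coset_avg_eq_0[OF rc] .
    qed
    then have "pre_cuspidal n r" by (rule coset_fil_imp_pre_cuspidal)
    then have Dr: "D' n r = D n r" using D D' rc False by (simp add: duality_family_def Suc_le_eq)
    have S: "D' n b = D n b" if "b \<in> S" for b
    proof -
      from that obtain n1 and x :: "'a mat" where n1: "0 < n1" "n1 < n" and x: "x \<in> color_parab n (two_block n1)"
        and b: "b = coset_avg n (two_block n1) x" unfolding S_def by auto
      define n2 where "n2 = n - n1"
      have n2: "n1 + n2 = n" "0 < n2" "n2 < n" using n1 by (auto simp: n2_def)
      \<comment> \<open>One colour on each block, with the second shifted by 1, concatenates to
        exactly \<open>two_block n1\<close>.\<close>
      let ?f1 = "coset_avg n1 (\<lambda>_. 0) (ul_block n1 x)" and ?f2 = "coset_avg n2 (\<lambda>_. 0) (lr_block n1 n2 x)"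
      let ?H = "HC_ind n1 n2 (ext_prod n1 n2 ?f1 ?f2)"
      have tb: "(\<lambda>i. if i < n1 then 0 else 0 + 1) = two_block n1" by (simp add: fun_eq_iff two_block_def)
      have "\<exists>c. c \<noteq> 0 \<and> ?H = (\<lambda>z. c * b z)"
        using HC_ind_coset_avg[of x n1 n2 "\<lambda>_. 0" 1 "\<lambda>_. 0"] x unfolding n2(1) tb b by simp
      then obtain c where c: "c \<noteq> 0" "?H = (\<lambda>z. c * b z)" by blast
      have Hc: "?H \<in> classfun n" using HC_ind_classfun[of n1 n2 ?f1 ?f2] unfolding n2(1) .
      have "D' (n1+n2) ?H = HC_ind n1 n2 (ext_prod n1 n2 (D' n1 ?f1) (D' n2 ?f2))"
        by (rule mult[OF D' n1(1) n2(2) coset_avg_classfun coset_avg_classfun])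
      also have "\<dots> = HC_ind n1 n2 (ext_prod n1 n2 (D n1 ?f1) (D n2 ?f2))"
        using less.IH[OF n1(2) coset_avg_classfun] less.IH[OF n2(3) coset_avg_classfun] by simp
      also have "\<dots> = D (n1+n2) ?H"
        by (rule mult[OF D n1(1) n2(2) coset_avg_classfun coset_avg_classfun, symmetric])
      finally have eq: "D' n ?H = D n ?H" unfolding n2(1) .
      have "b = (\<lambda>z. 1 / c * ?H z)" using c by (simp add: fun_eq_iff)
      moreover have "D n (\<lambda>z. 1 / c * ?H z) = (\<lambda>z. 1 / c * D n ?H z)" "D' n (\<lambda>z. 1 / c * ?H z) = (\<lambda>z. 1 / c * D' n ?H z)"
        using lin Hc unfolding lin_endo_def by blast+
      ultimately show ?thesis using eq by simp
    qed
    have Dw: "D' n w = D n w"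
      using w
    proof induction
      case fun_span_zero
      show ?case using lin_endo_sum[OF lin(1), of "{}"] lin_endo_sum[OF lin(2), of "{}"] by simp
    next
      case (fun_span_step b w c)
      then show ?case using add[OF _ wc[of w], of b c] S[of b] Sc by auto
    qed
    have "f = (\<lambda>x. 1 * w x + r x)" by (simp add: r_def)
    then show ?thesis using add[OF wc[OF w] rc, of 1] Dw Dr by metis
  qed
qed

theorem mainTheorem10:
  "\<exists>D :: nat \<Rightarrow> (('a::{finite,field}) mat \<Rightarrow> complex) \<Rightarrow> ('a mat \<Rightarrow> complex).
     duality_family D \<and>
     (\<forall>D'. duality_family D' \<longrightarrow> (\<forall>n. \<forall>f \<in> classfun n. D' n f = D n f))"
  using duality_family_cusp_dual duality_family_unique by blast

end
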